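(* Suppose that the set $\{x\in\mathbb{R}^n: Ax=b\}$ is nonempty and that $f:\mathbb{R}^n\to\mathbb{R}$ is proper, lower semicontinuous and $\rho$-weakly convex ($\rho>0$). Let $\gamma\in(0,\rho^{-1})$ and $\eta\in(0,2)$, and let $\{(x^k,z^k,\lambda^k)\}$ be a sequence generated by MEAL (defined in the context). Then the following hold. (a) Use a fixed penalty parameter $\beta_k=\beta$ for all $k$, with $\beta$ sufficiently large such that $$\alpha:=\frac{2\beta+\gamma\eta(1-\eta/2)}{2c_{\gamma,A}\beta^2}<\min\left\{\frac{1-\gamma\rho}{4\gamma(1+\gamma L_f)^2},\ \frac{1}{8\gamma}\Big(\frac{2}{\eta}-1\Big)\right\}.$$ If $f$ satisfies the implicit Lipschitz subgradient property with constant $L_f>0$ (possibly depending on $\gamma$) and the sequence $\{\mathcal{E}^k_{\mathrm{meal}}\}_{k\ge 1}$ is lower bounded, then $\xi^k_{\mathrm{meal}}=o(1/\sqrt{k})$. (b) Pick any $K\ge 1$. Set $\{\beta_k\}$ so that $\alpha_k\equiv \frac{\alpha^*}{K}$ for some positive constant $\alpha^*\le\min\left\{\frac{1-\rho\gamma}{6\gamma},\ \frac{1}{12\gamma}\big(\frac{2}{\eta}-1\big)\right\}$. If $f$ satisfies the implicit bounded subgradient property with constant $\hat L_f>0$ (possibly depending on $\gamma$) and the sequence $\{\tilde{\mathcal{E}}^k_{\mathrm{meal}}\}_{k\ge 1}$ is lower bounded, then $\xi^K_{\mathrm{meal}}\le \tilde c_1/\sqrt{K}$ for some constant $\tilde 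c_1>0$.
   Context: The problem is to minimize $f(x)$ over $x\in\mathbb{R}^n$ subject to $Ax=b$, with $A\in\mathbb{R}^{m\times n}$, $b\in\mathbb{R}^m$. $\|\cdot\|$ is the Euclidean norm. A function $h$ is $\rho$-weakly convex ($\rho>0$) if $h+\frac{\rho}{2}\|\cdot\|^2$ is convex. Moreau envelope and prox: $\mathcal{M}_{\gamma,h}(z)=\min_x\{h(x)+\frac1{2\gamma}\|x-z\|^2\}$, $\mathrm{Prox}_{\gamma,h}(z)=\operatorname{argmin}_x\{h(x)+\frac1{2\gamma}\|x-z\|^2\}$. If $h$ is proper, lower semicontinuous, $\rho$-weakly convex and $\gamma\in(0,\rho^{-1})$, the prox is single-valued and $\mathcal{M}_{\gamma,h}$ is differentiable with $\nabla\mathcal{M}_{\gamma,h}(z)=\gamma^{-1}(z-\mathrm{Prox}_{\gamma,h}(z))$. For $x\in\mathrm{ran}(\mathrm{Prox}_{\gamma,h})$ let $\mathrm{Prox}_{\gamma,h}^{-1}(x)=\{w:\mathrm{Prox}_{\gamma,h}(w)=x\}$. Implicit Lipschitz subgradient property of $h$: for any $\gamma\in(0,\rho^{-1})$ there is $L>0$ (depending on $\gamma$) such that for all $u,v\in\mathrm{ran}(\mathrm{Prox}_{\gamma,h})$, all $w\in\mathrm{Prox}_{\gamma,h}^{-1}(u)$ and $w'\in\mathrm{Prox}_{\gamma,h}^{-1}(v)$: $\|\nabla\mathcal{M}_{\gamma,h}(w)-\nabla\mathcal{M}_{\gamma,h}(w')\|\le L\|u-v\|$. Implicit bounded subgradient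 property of $h$: for any $\gamma\in(0,\rho^{-1})$ there is $\hat L>0$ (depending on $\gamma$) such that for all $u\in\mathrm{ran}(\mathrm{Prox}_{\gamma,h})$ and $w\in\mathrm{Prox}_{\gamma,h}^{-1}(u)$: $\|\nabla\mathcal{M}_{\gamma,h}(w)\|\le\hat L$. For $\beta>0$: $\mathcal{L}_\beta(x,\lambda)=f(x)+\langle\lambda,Ax-b\rangle+\frac\beta2\|Ax-b\|^2$, $\phi_\beta(z,\lambda)=\min_x\{\mathcal{L}_\beta(x,\lambda)+\frac1{2\gamma}\|x-z\|^2\}$, $\mathcal{P}_\beta(x,z,\lambda)=\mathcal{L}_\beta(x,\lambda)+\frac1{2\gamma}\|x-z\|^2$. MEAL: given $(z^0,\lambda^0)$, $\gamma>0$, $\eta\in(0,2)$ and penalty parameters $\beta_k>0$, for $k=0,1,\dots$: $x^{k+1}=\operatorname{argmin}_x\{\mathcal{L}_{\beta_k}(x,\lambda^k)+\frac1{2\gamma}\|x-z^k\|^2\}$, $z^{k+1}=z^k-\eta(z^k-x^{k+1})$, $\lambda^{k+1}=\lambda^k+\beta_k(Ax^{k+1}-b)$. Along the iterates, $\nabla\phi_{\beta_k}(z^k,\lambda^k)=\big(\gamma^{-1}(z^k-x^{k+1}),\,Ax^{k+1}-b\big)$ (gradient with respect to $(z,\lambda)$). Stationarity measure: $\xi^k_{\mathrm{meal}}=\min_{0\le t\le k}\|\nabla\phi_{\beta_t}(z^t,\lambda^t)\|$. Let $c_{\gamma,A}=\gamma^2\tilde\sigma_{\min}(A^TA)$, where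 $\tilde\sigma_{\min}(A^TA)$ is the smallest positive eigenvalue of $A^TA$, and $\alpha_k=\frac{\beta_k+\beta_{k+1}+\gamma\eta(1-\eta/2)}{2c_{\gamma,A}\beta_k^2}$ (so $\alpha_k=\alpha$ when $\beta_k\equiv\beta$). For $k\ge1$: $\mathcal{E}^k_{\mathrm{meal}}=\mathcal{P}_{\beta_k}(x^k,z^k,\lambda^k)+2\alpha_k\|z^k-z^{k-1}\|^2$, and $\tilde{\mathcal{E}}^k_{\mathrm{meal}}=\mathcal{P}_{\beta_k}(x^k,z^k,\lambda^k)+3\alpha_k\|z^k-z^{k-1}\|^2$. *)

theory Defs
  imports "HOL-Analysis.Analysis" "HOL-Library.Landau_Symbols"
begin

definition lower_semicont :: "('a::topological_space \<Rightarrow> real) \<Rightarrow> bool" where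
  "lower_semicont h \<longleftrightarrow> (\<forall>x. ereal (h x) \<le> Liminf (at x) (\<lambda>y. ereal (h y)))"

definition weakly_convex :: "real \<Rightarrow> ('a::real_normed_vector \<Rightarrow> real) \<Rightarrow> bool" where
  "weakly_convex \<rho> h \<longleftrightarrow> convex_on UNIV (\<lambda>x. h x + \<rho> / 2 * (norm x)^2)"

text \<open>Meaningful only where the function is differentiable.\<close>

definition grad :: "('a::real_inner \<Rightarrow> real) \<Rightarrow> 'a \<Rightarrow> 'a" where
  "grad F p = (THE D. GDERIV F p :> D)"

text \<open>For a \<open>\<rho>\<close>-weakly convex real-valued function on a Euclidean space and \<open>0 < \<gamma> < 1 / \<rho>\<close> the
  minimum below is attained at exactly one point, so the infimum is a minimum and the choice made
  by \<^const>\<open>arg_min\<close> is forced.\<close>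

definition moreau_env :: "real \<Rightarrow> ('a::real_inner \<Rightarrow> real) \<Rightarrow> 'a \<Rightarrow> real" where
  "moreau_env \<gamma> h z = (INF x. h x + 1 / (2 * \<gamma>) * (norm (x - z))^2)"

definition prox :: "real \<Rightarrow> ('a::real_inner \<Rightarrow> real) \<Rightarrow> 'a \<Rightarrow> 'a" where
  "prox \<gamma> h z = arg_min (\<lambda>x. h x + 1 / (2 * \<gamma>) * (norm (x - z))^2) (\<lambda>_. True)"

definition implicit_lipschitz_const :: "real \<Rightarrow> ('a::real_inner \<Rightarrow> real) \<Rightarrow> real \<Rightarrow> bool" where
  "implicit_lipschitz_const \<gamma> h L \<longleftrightarrow>
     L > 0 \<and>
     (\<forall>u \<in> range (prox \<gamma> h). \<forall>v \<in> range (prox \<gamma> h).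
        \<forall>w \<in> prox \<gamma> h -` {u}. \<forall>w' \<in> prox \<gamma> h -` {v}.
          norm (grad (moreau_env \<gamma> h) w - grad (moreau_env \<gamma> h) w') \<le> L * norm (u - v))"

definition implicit_lipschitz_subgradient :: "real \<Rightarrow> ('a::real_inner \<Rightarrow> real) \<Rightarrow> bool" where
  "implicit_lipschitz_subgradient \<rho> h \<longleftrightarrow>
     (\<forall>\<gamma> \<in> {0<..<1 / \<rho>}. \<exists>L. implicit_lipschitz_const \<gamma> h L)"

definition implicit_bounded_const :: "real \<Rightarrow> ('a::real_inner \<Rightarrow> real) \<Rightarrow> real \<Rightarrow> bool" where
  "implicit_bounded_const \<gamma> h L \<longleftrightarrow>
     L > 0 \<and>
     (\<forall>u \<in> range (prox \<gamma> h). \<forall>w \<in> prox \<gamma> h -` {u}. norm (grad (moreau_env \<gamma> h) w) \<le> L)"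

definition implicit_bounded_subgradient :: "real \<Rightarrow> ('a::real_inner \<Rightarrow> real) \<Rightarrow> bool" where
  "implicit_bounded_subgradient \<rho> h \<longleftrightarrow>
     (\<forall>\<gamma> \<in> {0<..<1 / \<rho>}. \<exists>L. implicit_bounded_const \<gamma> h L)"

definition aug_lagrangian ::
  "(real^'n \<Rightarrow> real) \<Rightarrow> real^'n^'m \<Rightarrow> real^'m \<Rightarrow> real \<Rightarrow> real^'n \<Rightarrow> real^'m \<Rightarrow> real" where
  "aug_lagrangian f A b \<beta> x lam =
     f x + lam \<bullet> (A *v x - b) + \<beta> / 2 * (norm (A *v x - b))^2"

definition prox_lagrangian ::
  "(real^'n \<Rightarrow> real) \<Rightarrow> real^'n^'m \<Rightarrow> real^'m \<Rightarrow> real \<Rightarrow> real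
     \<Rightarrow> real^'n \<Rightarrow> real^'n \<Rightarrow> real^'m \<Rightarrow> real" where
  "prox_lagrangian f A b \<gamma> \<beta> x z lam =
     aug_lagrangian f A b \<beta> x lam + 1 / (2 * \<gamma>) * (norm (x - z))^2"

text \<open>A function of the pair \<open>(z, \<lambda>)\<close>, so that \<^const>\<open>grad\<close> is the joint gradient and the product
  norm is the Euclidean one.\<close>

definition meal_phi ::
  "(real^'n \<Rightarrow> real) \<Rightarrow> real^'n^'m \<Rightarrow> real^'m \<Rightarrow> real \<Rightarrow> real \<Rightarrow> (real^'n) \<times> (real^'m) \<Rightarrow> real" where
  "meal_phi f A b \<gamma> \<beta> = (\<lambda>(z, lam). INF x. prox_lagrangian f A b \<gamma> \<beta> x z lam)"

text \<open>The recursion starts from \<open>z 0\<close> and \<open>lam 0\<close>; \<open>x 0\<close> is a dummy.\<close>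

definition meal_seq ::
  "(real^'n \<Rightarrow> real) \<Rightarrow> real^'n^'m \<Rightarrow> real^'m \<Rightarrow> real \<Rightarrow> real \<Rightarrow> (nat \<Rightarrow> real)
     \<Rightarrow> (nat \<Rightarrow> real^'n) \<Rightarrow> (nat \<Rightarrow> real^'n) \<Rightarrow> (nat \<Rightarrow> real^'m) \<Rightarrow> bool" where
  "meal_seq f A b \<gamma> \<eta> \<beta> x z lam \<longleftrightarrow>
     (\<forall>k. \<beta> k > 0) \<and>
     (\<forall>k. is_arg_min (\<lambda>y. prox_lagrangian f A b \<gamma> (\<beta> k) y (z k) (lam k)) (\<lambda>_. True) (x (Suc k)) \<and>
          z (Suc k) = z k - \<eta> *\<^sub>R (z k - x (Suc k)) \<and>
          lam (Suc k) = lam k + \<beta> k *\<^sub>R (A *v x (Suc k) - b))"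

definition meal_xi ::
  "(real^'n \<Rightarrow> real) \<Rightarrow> real^'n^'m \<Rightarrow> real^'m \<Rightarrow> real \<Rightarrow> (nat \<Rightarrow> real)
     \<Rightarrow> (nat \<Rightarrow> real^'n) \<Rightarrow> (nat \<Rightarrow> real^'m) \<Rightarrow> nat \<Rightarrow> real" where
  "meal_xi f A b \<gamma> \<beta> z lam k =
     Min ((\<lambda>t. norm (grad (meal_phi f A b \<gamma> (\<beta> t)) (z t, lam t))) ` {0..k})"

text \<open>Meaningful only if a positive eigenvalue exists; for \<open>M = A\<^sup>T A\<close> this means \<open>A \<noteq> 0\<close>.\<close>

definition min_pos_eigenvalue :: "real^'n^'n \<Rightarrow> real" where
  "min_pos_eigenvalue M = Min {\<mu>. \<mu> > 0 \<and> (\<exists>v. v \<noteq> 0 \<and> M *v v = \<mu> *\<^sub>R v)}"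

definition meal_c :: "real \<Rightarrow> real^'n^'m \<Rightarrow> real" where
  "meal_c \<gamma> A = \<gamma>^2 * min_pos_eigenvalue (transpose A ** A)"

definition meal_alpha :: "real^'n^'m \<Rightarrow> real \<Rightarrow> real \<Rightarrow> (nat \<Rightarrow> real) \<Rightarrow> nat \<Rightarrow> real" where
  "meal_alpha A \<gamma> \<eta> \<beta> k =
     (\<beta> k + \<beta> (Suc k) + \<gamma> * \<eta> * (1 - \<eta> / 2)) / (2 * meal_c \<gamma> A * (\<beta> k)^2)"

text \<open>Both energies are used for \<open>k \<ge> 1\<close> only.\<close>

definition meal_energy ::
  "(real^'n \<Rightarrow> real) \<Rightarrow> real^'n^'m \<Rightarrow> real^'m \<Rightarrow> real \<Rightarrow> real \<Rightarrow> (nat \<Rightarrow> real)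
     \<Rightarrow> (nat \<Rightarrow> real^'n) \<Rightarrow> (nat \<Rightarrow> real^'n) \<Rightarrow> (nat \<Rightarrow> real^'m) \<Rightarrow> nat \<Rightarrow> real" where
  "meal_energy f A b \<gamma> \<eta> \<beta> x z lam k =
     prox_lagrangian f A b \<gamma> (\<beta> k) (x k) (z k) (lam k)
       + 2 * meal_alpha A \<gamma> \<eta> \<beta> k * (norm (z k - z (k - 1)))^2"

definition meal_energy_tilde ::
  "(real^'n \<Rightarrow> real) \<Rightarrow> real^'n^'m \<Rightarrow> real^'m \<Rightarrow> real \<Rightarrow> real \<Rightarrow> (nat \<Rightarrow> real)
     \<Rightarrow> (nat \<Rightarrow> real^'n) \<Rightarrow> (nat \<Rightarrow> real^'n) \<Rightarrow> (nat \<Rightarrow> real^'m) \<Rightarrow> nat \<Rightarrow> real" where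
  "meal_energy_tilde f A b \<gamma> \<eta> \<beta> x z lam k =
     prox_lagrangian f A b \<gamma> (\<beta> k) (x k) (z k) (lam k)
       + 3 * meal_alpha A \<gamma> \<eta> \<beta> k * (norm (z k - z (k - 1)))^2"

end

theory Submission
  imports Defs
begin

text \<open>Everything rests on one inequality. Because \<open>f\<close> is weakly convex, optimality of \<open>x\<^sup>k\<^sup>+\<^sup>1\<close> for the
  proximal augmented Lagrangian \<open>P\<close> says that
  \<open>s\<^sup>k = (z\<^sup>k - x\<^sup>k\<^sup>+\<^sup>1) / \<gamma> - A\<^sup>T \<lambda>\<^sup>k\<^sup>+\<^sup>1\<close> is a subgradient of \<open>f\<close> at \<open>x\<^sup>k\<^sup>+\<^sup>1\<close> up to the error
  \<open>\<rho> / 2 \<cdot> |y - x\<^sup>k\<^sup>+\<^sup>1|\<^sup>2\<close> (\<open>prox_lagrangian_argmin_weak_subgradient\<close>). Such a pair \<open>(u, s)\<close> satisfies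
  \<open>u = Prox (u + \<gamma> s)\<close>, and \<open>s\<close> is the gradient of the Moreau envelope at \<open>u + \<gamma> s\<close>. The implicit
  subgradient hypotheses therefore say that \<open>s\<^sup>k\<close> depends on \<open>x\<^sup>k\<^sup>+\<^sup>1\<close> in a Lipschitz way, or that it is
  bounded. The same growth argument yields the gradient of \<open>\<phi>\<close> at \<open>(z\<^sup>k, \<lambda>\<^sup>k)\<close> (\<open>grad_meal_phi\<close>).

  In one iteration the \<open>x\<close>- and the \<open>z\<close>-step decrease \<open>P\<close> by multiples of the squared moves, and the
  multiplier and penalty updates together increase it. The number \<open>\<alpha>\<^sub>k\<close> is chosen so that this increase
  is \<open>\<alpha>\<^sub>k c |\<lambda>\<^sup>k\<^sup>+\<^sup>1 - \<lambda>\<^sup>k|\<^sup>2\<close> minus a multiple of \<open>|A x\<^sup>k\<^sup>+\<^sup>1 - b|\<^sup>2\<close>, which combines with half of the gain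
  of the \<open>z\<close>-step to the same multiple of \<open>|\<nabla>\<phi>|\<^sup>2\<close> (\<open>P_descent\<close>). The multiplier moves inside the range of \<open>A\<close>, where
  \<open>|A\<^sup>T w|\<^sup>2\<close> is at least the smallest positive eigenvalue of \<open>A\<^sup>T A\<close> times \<open>|w|\<^sup>2\<close>; and the
  definition of \<open>s\<^sup>k\<close> expresses \<open>A\<^sup>T (\<lambda>\<^sup>k\<^sup>+\<^sup>1 - \<lambda>\<^sup>k)\<close> by the previous move of \<open>z\<close>, the move of \<open>x\<close> and
  \<open>s\<^sup>k\<^sup>-\<^sup>1 - s\<^sup>k\<close>. The previous move of \<open>z\<close> is absorbed by the extra term of the energy, the move of
  \<open>x\<close> by the decrease of the \<open>x\<close>-step. What remains is
  \<open>\<E>\<^sup>k - \<E>\<^sup>k\<^sup>+\<^sup>1 \<ge> const \<cdot> |\<nabla>\<phi>|\<^sup>2\<close>, with an additional error of order \<open>\<alpha>\<^sub>k\<close> in the bounded case.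

  With Lipschitz subgradients the squared gradients are summable, and the least of the first \<open>k\<close>
  terms of a square-summable sequence is \<open>o(1 / \<surd>k)\<close>. With bounded subgradients \<open>K\<close> errors of order
  \<open>1 / K\<close> add up to a constant, so that the sum of the first \<open>K\<close> squares is bounded by the first energy
  plus a constant. The penalty parameters vary with \<open>K\<close>, so for a constant that serves every \<open>K\<close> the first
  energy must be bounded independently of them. Comparing \<open>x\<^sup>1\<close> with a feasible
  point bounds \<open>x\<^sup>1\<close>, since the penalty only enters with the favourable sign
  (\<open>first_iterate_bound\<close>). Then \<open>A\<^sup>T (\<lambda>\<^sup>1 - \<lambda>\<^sup>0)\<close>, hence \<open>\<lambda>\<^sup>1 - \<lambda>\<^sup>0\<close>, is
  bounded, and \<open>\<alpha>\<^sub>0 c |\<lambda>\<^sup>1 - \<lambda>\<^sup>0|\<^sup>2\<close> dominates all penalty terms of the first energy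
  (\<open>energy_tilde_first_bound\<close>).\<close>

section \<open>Squares and quadratic inequalities\<close>

text \<open>The form in which first-order optimality is used: moving a distance \<open>t\<close> away from a minimiser
  changes the objective by \<open>a t\<close> plus a remainder of order \<open>t\<^sup>2\<close>.\<close>

lemma slope_nonneg_of_quadratic_nonneg:
  fixes a c :: real
  assumes "\<And>t. 0 < t \<Longrightarrow> t < 1 \<Longrightarrow> 0 \<le> a * t + c * t\<^sup>2"
  shows "0 \<le> a"
proof (rule tendsto_lowerbound)
  show "((\<lambda>t. a + c * t) \<longlongrightarrow> a) (at_right 0)" by (auto intro!: tendsto_eq_intros)
  show "\<forall>\<^sub>F t in at_right 0. 0 \<le> a + c * t"
    unfolding eventually_at_right_field
  proof (intro exI[of _ 1] conjI allI impI)
    fix t :: real assume t: "0 < t" "t < 1"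
    have "0 \<le> (a + c * t) * t" using assms[OF t] by (simp add: power2_eq_square algebra_simps)
    then show "0 \<le> a + c * t" using t(1) by (simp add: zero_le_mult_iff)
  qed simp
qed simp

lemma norm_add_square:
  fixes a d :: "'a::real_inner"
  shows "(norm (a + d))\<^sup>2 = (norm a)\<^sup>2 + 2 * (a \<bullet> d) + (norm d)\<^sup>2"
  by (simp add: power2_norm_eq_inner inner_simps inner_commute)

lemma norm_add_scale_square:
  fixes a d :: "'a::real_inner"
  shows "(norm (a + t *\<^sub>R d))\<^sup>2 = (norm a)\<^sup>2 + 2 * t * (a \<bullet> d) + t\<^sup>2 * (norm d)\<^sup>2"
  by (simp add: norm_add_square power_mult_distrib)

lemma norm_sum2_square_le:
  fixes a b :: "'a::real_inner"
  shows "(norm (a + b))\<^sup>2 \<le> 2 * (norm a)\<^sup>2 + 2 * (norm b)\<^sup>2"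
proof -
  have "0 \<le> (norm (a + - b))\<^sup>2" by (rule zero_le_power2)
  then have "2 * (a \<bullet> b) \<le> (norm a)\<^sup>2 + (norm b)\<^sup>2" unfolding norm_add_square by simp
  then show ?thesis unfolding norm_add_square by simp
qed

lemma real_sum2_square_le: "(p + q)\<^sup>2 \<le> 2 * p\<^sup>2 + 2 * q\<^sup>2" for p q :: real
  using norm_sum2_square_le[of p q] by simp

lemma norm_sum3_square_le:
  fixes a b c :: "'a::real_inner"
  shows "(norm (a + b + c))\<^sup>2 \<le> 3 * (norm a)\<^sup>2 + 3 * (norm b)\<^sup>2 + 3 * (norm c)\<^sup>2"
proof -
  have "0 \<le> (norm (a - b))\<^sup>2 + (norm (b - c))\<^sup>2 + (norm (a - c))\<^sup>2" by simp
  then show ?thesis by (simp add: power2_norm_eq_inner inner_simps inner_commute)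
qed

lemma quadratic_lower_bound:
  fixes \<mu> a r :: real
  assumes "\<mu> > 0"
  shows "- (a\<^sup>2 / (2 * \<mu>)) \<le> \<mu> / 2 * r\<^sup>2 - a * r"
proof -
  have "0 \<le> (\<mu> * r - a)\<^sup>2 / (2 * \<mu>)" using assms by simp
  also have "\<dots> = \<mu> / 2 * r\<^sup>2 - a * r + a\<^sup>2 / (2 * \<mu>)"
    using assms by (simp add: field_simps power2_eq_square)
  finally show ?thesis by simp
qed

text \<open>With \<open>p = 2 / \<eta> - 1\<close> the right-hand side is the coefficient of the half of the \<open>z\<close>-step's gain that
  is available for absorption. The energies absorb \<open>2 a\<close> and \<open>3 a\<close>, which are the cases \<open>c = 8\<close> and \<open>c = 12\<close>.\<close>

lemma quarter_coefficient:
  fixes a c \<gamma> p :: real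
  assumes "a \<le> 1 / (c * \<gamma>) * p" and "c > 0"
  shows "c / 4 * a \<le> p / (4 * \<gamma>)"
proof -
  have "c / 4 * a \<le> c / 4 * (1 / (c * \<gamma>) * p)" using assms by (intro mult_left_mono) auto
  also have "\<dots> = p / (4 * \<gamma>)" using assms(2) by simp
  finally show ?thesis .
qed

section \<open>The smallest positive eigenvalue\<close>

lemma inner_transpose_mult:
  fixes A :: "real^'n^'m"
  shows "(transpose A *v y) \<bullet> v = y \<bullet> (A *v v)"
  by (simp add: transpose_matrix_vector dot_lmul_matrix)

text \<open>Eigenvectors to distinct eigenvalues are orthogonal, and a family of pairwise orthogonal
  vectors is finite. This makes the minimum defining \<^const>\<open>min_pos_eigenvalue\<close> a true minimum.\<close>

lemma finite_eigenvalues_symmetric: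
  fixes M :: "real^'n^'n"
  assumes sym: "transpose M = M"
  shows "finite {\<mu>. \<exists>v. v \<noteq> 0 \<and> M *v v = \<mu> *\<^sub>R v}" (is "finite ?S")
proof -
  have "\<forall>\<mu>\<in>?S. \<exists>v. v \<noteq> 0 \<and> M *v v = \<mu> *\<^sub>R v" by blast
  from bchoice[OF this] obtain e
    where "\<forall>\<mu>\<in>?S. e \<mu> \<noteq> 0 \<and> M *v e \<mu> = \<mu> *\<^sub>R e \<mu>" ..
  then have e: "e \<mu> \<noteq> 0 \<and> M *v e \<mu> = \<mu> *\<^sub>R e \<mu>" if "\<mu> \<in> ?S" for \<mu> using that by blast
  have orth: "e \<mu> \<bullet> e \<nu> = 0" if "\<mu> \<in> ?S" "\<nu> \<in> ?S" "\<mu> \<noteq> \<nu>" for \<mu> \<nu>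
  proof -
    have "(M *v e \<mu>) \<bullet> e \<nu> = e \<mu> \<bullet> (M *v e \<nu>)"
      using inner_transpose_mult[of M "e \<mu>" "e \<nu>"] sym by simp
    then have "(\<mu> - \<nu>) * (e \<mu> \<bullet> e \<nu>) = 0"
      using e[OF that(1)] e[OF that(2)] by (simp add: algebra_simps)
    then show ?thesis using that(3) by simp
  qed
  have "pairwise orthogonal (e ` ?S)"
    unfolding pairwise_def orthogonal_def using orth by blast
  then have "finite (e ` ?S)" by (rule pairwise_orthogonal_imp_finite)
  moreover have "inj_on e ?S"
  proof (rule inj_onI)
    fix \<mu> \<nu> assume *: "\<mu> \<in> ?S" "\<nu> \<in> ?S" "e \<mu> = e \<nu>"
    then have "e \<mu> \<bullet> e \<nu> \<noteq> 0" using e[OF *(1)] by simp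
    then show "\<mu> = \<nu>" using orth[OF *(1,2)] by blast
  qed
  ultimately show ?thesis by (rule finite_imageD)
qed

text \<open>Variational characterisation: a minimiser \<open>w\<close> of \<open>|A\<^sup>T w|\<^sup>2\<close> over the unit sphere of the range of
  \<open>A\<close> is an eigenvector of \<open>A A\<^sup>T\<close>, and \<open>A\<^sup>T w\<close> is then an eigenvector of \<open>A\<^sup>T A\<close> with the same
  eigenvalue, namely the minimal value. Minimising over the range of \<open>A\<close> instead of the whole space
  excludes the kernel of \<open>A\<^sup>T\<close>, so that the value is positive.\<close>

lemma ex_pos_eigenvalue_bound:
  fixes A :: "real^'n^'m"
  assumes "A \<noteq> 0"
  shows "\<exists>\<mu>>0. (\<exists>v. v \<noteq> 0 \<and> (transpose A ** A) *v v = \<mu> *\<^sub>R v)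
    \<and> (\<forall>d. \<mu> * (norm (A *v d))\<^sup>2 \<le> (norm (transpose A *v (A *v d)))\<^sup>2)"
proof -
  let ?R = "range ((*v) A)" and ?B = "transpose A"
  have lin: "linear ((*v) A)" "linear ((*v) ?B)" by auto
  have sub: "subspace ?R" by (rule linear_subspace_image[OF lin(1) subspace_UNIV])
  obtain d0 where d0: "A *v d0 \<noteq> 0"
    using assms by (metis matrix_eq matrix_vector_mult_0)
  let ?S = "?R \<inter> sphere 0 1"
  have "(1 / norm (A *v d0)) *\<^sub>R (A *v d0) \<in> ?S"
    using d0 sub by (auto intro!: subspace_scale)
  then have ne: "?S \<noteq> {}" by blast
  have "compact ?S"
    using closed_subspace[OF sub] by (intro closed_Int_compact) auto
  moreover have "continuous_on ?S (\<lambda>w. (norm (?B *v w))\<^sup>2)"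
    by (intro continuous_intros linear_continuous_on linear_linear[THEN iffD2] lin)
  ultimately obtain w where w: "w \<in> ?S"
    and wmin: "\<And>y. y \<in> ?S \<Longrightarrow> (norm (?B *v w))\<^sup>2 \<le> (norm (?B *v y))\<^sup>2"
    using continuous_attains_inf[OF _ ne] by blast
  obtain d where d: "w = A *v d" and nw: "norm w = 1" using w by auto
  define \<mu> where "\<mu> = (norm (?B *v w))\<^sup>2"
  have Bw: "?B *v w \<noteq> 0"
  proof
    assume "?B *v w = 0"
    then have "w \<bullet> w = 0" using inner_transpose_mult[of A w d] d by simp
    with nw show False by simp
  qed
  then have mu: "\<mu> > 0" by (simp add: \<mu>_def)
  have bound: "\<mu> * (norm y)\<^sup>2 \<le> (norm (?B *v y))\<^sup>2" if "y \<in> ?R" for y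
  proof (cases "y = 0")
    case False
    have "(1 / norm y) *\<^sub>R y \<in> ?S" using False that sub by (auto intro!: subspace_scale)
    then have "\<mu> \<le> (norm (?B *v ((1 / norm y) *\<^sub>R y)))\<^sup>2" unfolding \<mu>_def by (rule wmin)
    then show ?thesis using False
      by (simp add: matrix_vector_mult_scaleR power_mult_distrib power_divide field_simps)
  qed simp
  \<comment> \<open>Half the gradient of \<open>|A\<^sup>T y|\<^sup>2 - \<mu> |y|\<^sup>2\<close> at \<open>w\<close>. It lies in the range of \<open>A\<close>, so \<open>- g\<close> is an
    admissible direction, along which this nonnegative form would become negative unless \<open>g = 0\<close>.\<close>
  define g where "g = A *v (?B *v w) - \<mu> *\<^sub>R w"
  have gR: "g \<in> ?R" unfolding g_def using sub w by (auto intro!: subspace_diff subspace_scale)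
  have "g \<bullet> g = 0"
  proof -
    have wg: "(?B *v w) \<bullet> (?B *v g) - \<mu> * (w \<bullet> g) = g \<bullet> g"
    proof -
      have "(?B *v w) \<bullet> (?B *v g) = (A *v (?B *v w)) \<bullet> g"
        by (metis inner_commute inner_transpose_mult)
      then show ?thesis by (simp add: g_def inner_diff_left)
    qed
    then have wg': "(?B *v w) \<bullet> (?B *v g) = g \<bullet> g + \<mu> * (w \<bullet> g)" by linarith
    have ineq: "0 \<le> 2 * t * (g \<bullet> g) + t\<^sup>2 * ((norm (?B *v g))\<^sup>2 - \<mu> * (norm g)\<^sup>2)" for t
    proof -
      have "w + t *\<^sub>R g \<in> ?R" using w gR sub by (auto intro!: subspace_add subspace_scale)
      from bound[OF this] have "\<mu> * (norm (w + t *\<^sub>R g))\<^sup>2 \<le> (norm (?B *v w + t *\<^sub>R (?B *v g)))\<^sup>2"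
        by (simp only: matrix_vector_right_distrib matrix_vector_mult_scaleR)
      then have "\<mu> * ((norm w)\<^sup>2 + 2 * t * (w \<bullet> g) + t\<^sup>2 * (norm g)\<^sup>2)
          \<le> (norm (?B *v w))\<^sup>2 + 2 * t * ((?B *v w) \<bullet> (?B *v g)) + t\<^sup>2 * (norm (?B *v g))\<^sup>2"
        by (simp only: norm_add_scale_square)
      then have "\<mu> * (1 + 2 * t * (w \<bullet> g) + t\<^sup>2 * (norm g)\<^sup>2)
          \<le> \<mu> + 2 * t * (g \<bullet> g + \<mu> * (w \<bullet> g)) + t\<^sup>2 * (norm (?B *v g))\<^sup>2"
        using wg' nw unfolding \<mu>_def[symmetric] by simp
      then show ?thesis by (simp add: algebra_simps)
    qed
    have "0 \<le> - 2 * (g \<bullet> g)"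
    proof (rule slope_nonneg_of_quadratic_nonneg)
      fix t :: real
      show "0 \<le> - 2 * (g \<bullet> g) * t + ((norm (?B *v g))\<^sup>2 - \<mu> * (norm g)\<^sup>2) * t\<^sup>2"
        using ineq[of "- t"] by (simp add: mult_ac)
    qed
    then show ?thesis using inner_ge_zero[of g] by linarith
  qed
  then have AB: "A *v (?B *v w) = \<mu> *\<^sub>R w" by (simp add: g_def)
  have "(?B ** A) *v (?B *v w) = ?B *v (A *v (?B *v w))"
    by (simp only: matrix_vector_mul_assoc[symmetric])
  also have "\<dots> = \<mu> *\<^sub>R (?B *v w)" unfolding AB by (rule matrix_vector_mult_scaleR)
  finally show ?thesis using mu Bw bound by blast
qed

text \<open>The smallest positive eigenvalue is at most the eigenvalue just found and inherits its bound. The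
  restriction to vectors \<open>A d\<close> matters: \<open>A\<^sup>T\<close> vanishes on the orthogonal complement of the range.\<close>

lemma min_pos_eigenvalue_bound:
  fixes A :: "real^'n^'m"
  assumes "A \<noteq> 0"
  shows "min_pos_eigenvalue (transpose A ** A) > 0"
    and "min_pos_eigenvalue (transpose A ** A) * (norm (A *v d))\<^sup>2
      \<le> (norm (transpose A *v (A *v d)))\<^sup>2"
proof -
  let ?M = "transpose A ** A"
  let ?S = "{\<mu>. \<mu> > 0 \<and> (\<exists>v. v \<noteq> 0 \<and> ?M *v v = \<mu> *\<^sub>R v)}"
  have "finite {\<mu>. \<exists>v. v \<noteq> 0 \<and> ?M *v v = \<mu> *\<^sub>R v}"
    by (rule finite_eigenvalues_symmetric) (simp add: matrix_transpose_mul)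
  then have fin: "finite ?S" by (rule rev_finite_subset) blast
  obtain \<mu> where mu: "\<mu> \<in> ?S"
    and bound: "\<mu> * (norm (A *v d))\<^sup>2 \<le> (norm (transpose A *v (A *v d)))\<^sup>2"
    using ex_pos_eigenvalue_bound[OF assms] by blast
  have "Min ?S \<in> ?S" using fin mu by (intro Min_in) auto
  then show "min_pos_eigenvalue ?M > 0" unfolding min_pos_eigenvalue_def by simp
  have "min_pos_eigenvalue ?M \<le> \<mu>" unfolding min_pos_eigenvalue_def using fin mu by (rule Min_le)
  then show "min_pos_eigenvalue ?M * (norm (A *v d))\<^sup>2 \<le> (norm (transpose A *v (A *v d)))\<^sup>2"
    using bound by (meson mult_right_mono order_trans zero_le_power2)
qed

section \<open>Weak subgradients, proximal points and gradients of envelopes\<close>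

text \<open>The inequality \<open>f x + s \<bullet> (y - x) \<le> f y\<close> of convex analysis, relaxed by the modulus
  \<open>\<rho> / 2\<close>: \<open>s\<close> satisfies it iff \<open>s + \<rho> x\<close> is an ordinary global subgradient of \<open>f + \<rho> / 2 \<cdot> |\<cdot>|\<^sup>2\<close> at \<open>x\<close>.\<close>

definition weak_subgradient :: "real \<Rightarrow> ('a::real_inner \<Rightarrow> real) \<Rightarrow> 'a \<Rightarrow> 'a \<Rightarrow> bool" where
  "weak_subgradient \<rho> f x s \<longleftrightarrow> (\<forall>y. f x + s \<bullet> (y - x) - \<rho> / 2 * (norm (y - x))\<^sup>2 \<le> f y)"

lemma grad_eqI:
  assumes "GDERIV F p :> D"
  shows "grad F p = D"
  unfolding grad_def
proof (rule the_equality[of _ D])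
  show "GDERIV F p :> D" by fact
  fix D' assume "GDERIV F p :> D'"
  with assms have "(\<lambda>h. h \<bullet> D') = (\<lambda>h. h \<bullet> D)"
    unfolding gderiv_def by (metis has_derivative_unique)
  then have "(D' - D) \<bullet> D' = (D' - D) \<bullet> D" by meson
  then have "(D' - D) \<bullet> (D' - D) = 0" by (simp add: inner_diff_right)
  then show "D' = D" by simp
qed

text \<open>An envelope theorem with explicit error. Freezing \<open>y = u\<close> bounds the infimum at \<open>p + \<delta>\<close> from
  above by its linearisation plus \<open>O(|\<delta>|\<^sup>2)\<close>. From below, the dependence of the slope on \<open>y\<close> costs at most
  a multiple of \<open>|\<delta>| |y - u|\<close>, which the quadratic growth of \<open>F\<close> turns into \<open>O(|\<delta>|\<^sup>2)\<close> by completing the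
  square. Two instances are needed: the Moreau envelope and the function \<open>\<phi>\<close> of both \<open>z\<close> and \<open>\<lambda>\<close>, in
  which \<open>Q\<close> selects the component that enters quadratically.\<close>

lemma gderiv_INF_quadratic_growth:
  fixes F :: "'a::real_normed_vector \<Rightarrow> real" and P :: "'a \<Rightarrow> 'p::real_inner \<Rightarrow> real"
  assumes mu: "\<mu> > 0" and T: "bounded_linear T"
    and growth: "\<And>y. F u + \<mu> / 2 * (norm (y - u))\<^sup>2 \<le> F y"
    and P: "\<And>y \<delta>. P y (p + \<delta>) = F y + \<delta> \<bullet> (D + T (y - u)) + c * (norm (Q \<delta>))\<^sup>2"
    and c: "c \<ge> 0" and Q: "\<And>\<delta>. norm (Q \<delta>) \<le> norm \<delta>"
  shows "GDERIV (\<lambda>q. INF y. P y q) p :> D"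
proof -
  let ?\<phi> = "\<lambda>q. INF y. P y q"
  obtain B where B: "\<And>d. norm (T d) \<le> norm d * B" and B0: "B > 0"
    using bounded_linear.pos_bounded[OF T] by blast
  define C where "C = B\<^sup>2 / (2 * \<mu>) + c"
  have C0: "C > 0" using mu B0 c by (simp add: C_def add_pos_nonneg)
  have lower: "F u + \<delta> \<bullet> D - C * (norm \<delta>)\<^sup>2 \<le> P y (p + \<delta>)" for y \<delta>
  proof -
    have "\<bar>\<delta> \<bullet> T (y - u)\<bar> \<le> norm \<delta> * norm (T (y - u))" by (rule Cauchy_Schwarz_ineq2)
    also have "\<dots> \<le> norm \<delta> * (norm (y - u) * B)" by (intro mult_left_mono B) simp
    finally have "- ((norm \<delta> * B) * norm (y - u)) \<le> \<delta> \<bullet> T (y - u)" by (simp add: mult_ac)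
    moreover have "- ((norm \<delta> * B)\<^sup>2 / (2 * \<mu>))
        \<le> \<mu> / 2 * (norm (y - u))\<^sup>2 - (norm \<delta> * B) * norm (y - u)"
      by (rule quadratic_lower_bound[OF mu])
    moreover have "C * (norm \<delta>)\<^sup>2 = (norm \<delta> * B)\<^sup>2 / (2 * \<mu>) + c * (norm \<delta>)\<^sup>2"
      by (simp add: C_def algebra_simps power_mult_distrib)
    moreover have "0 \<le> c * (norm (Q \<delta>))\<^sup>2" "0 \<le> c * (norm \<delta>)\<^sup>2" using c by auto
    ultimately show ?thesis
      using growth[of y] unfolding P inner_add_right by linarith
  qed
  have upper: "P u (p + \<delta>) \<le> F u + \<delta> \<bullet> D + C * (norm \<delta>)\<^sup>2" for \<delta>
  proof -
    have "T 0 = 0" using T by (simp add: linear_simps)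
    moreover have "c * (norm (Q \<delta>))\<^sup>2 \<le> c * (norm \<delta>)\<^sup>2"
      by (intro mult_left_mono power_mono Q c) simp
    moreover have "0 \<le> B\<^sup>2 / (2 * \<mu>) * (norm \<delta>)\<^sup>2" using mu by simp
    moreover have "P u (p + \<delta>) = F u + \<delta> \<bullet> D + c * (norm (Q \<delta>))\<^sup>2"
      using P[of u \<delta>] \<open>T 0 = 0\<close> by simp
    ultimately show ?thesis unfolding C_def distrib_right by linarith
  qed
  have phi: "\<bar>?\<phi> (p + \<delta>) - F u - \<delta> \<bullet> D\<bar> \<le> C * (norm \<delta>)\<^sup>2" for \<delta>
  proof -
    have "F u + \<delta> \<bullet> D - C * (norm \<delta>)\<^sup>2 \<le> ?\<phi> (p + \<delta>)"
      by (rule cINF_greatest) (auto intro: lower)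
    moreover have "?\<phi> (p + \<delta>) \<le> P u (p + \<delta>)"
      by (rule cINF_lower) (auto intro!: bdd_belowI2 lower)
    ultimately show ?thesis using upper[of \<delta>] by linarith
  qed
  have phi0: "?\<phi> p = F u" using phi[of 0] by simp
  have "(?\<phi> has_derivative (\<lambda>h. h \<bullet> D)) (at p)"
    unfolding has_derivative_at_alt
  proof (intro conjI allI impI)
    show "bounded_linear (\<lambda>h. h \<bullet> D)" by (rule bounded_linear_inner_left)
    fix e :: real assume e: "0 < e"
    have "norm (?\<phi> q - ?\<phi> p - (q - p) \<bullet> D) \<le> e * norm (q - p)" if "norm (q - p) < e / C" for q
    proof -
      have "norm (?\<phi> q - ?\<phi> p - (q - p) \<bullet> D) \<le> C * (norm (q - p))\<^sup>2"
        using phi[of "q - p"] phi0 by simp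
      also have "\<dots> \<le> e * norm (q - p)"
        using that C0 mult_right_mono[of "C * norm (q - p)" e "norm (q - p)"]
        by (simp add: power2_eq_square field_simps)
      finally show ?thesis .
    qed
    then show "\<exists>d>0. \<forall>q. norm (q - p) < d \<longrightarrow> norm (?\<phi> q - ?\<phi> p - (q - p) \<bullet> D) \<le> e * norm (q - p)"
      using e C0 by (intro exI[of _ "e / C"]) auto
  qed
  then show ?thesis unfolding gderiv_def .
qed

text \<open>The linear term of the weak subgradient inequality cancels against that of the proximal
  term centred at \<open>u + \<gamma> s\<close>; the curvature \<open>1 / \<gamma>\<close> outweighs \<open>\<rho>\<close> as soon as \<open>\<gamma> \<rho> < 1\<close>.\<close>

lemma prox_growth:
  assumes s: "weak_subgradient \<rho> f u s" and gam: "\<gamma> > 0"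
  shows "f u + 1 / (2 * \<gamma>) * (norm (u - (u + \<gamma> *\<^sub>R s)))\<^sup>2 + (1 / \<gamma> - \<rho>) / 2 * (norm (y - u))\<^sup>2
    \<le> f y + 1 / (2 * \<gamma>) * (norm (y - (u + \<gamma> *\<^sub>R s)))\<^sup>2"
proof -
  have "1 / (2 * \<gamma>) * (norm (y - (u + \<gamma> *\<^sub>R s)))\<^sup>2
      = 1 / (2 * \<gamma>) * (norm (y - u))\<^sup>2 - s \<bullet> (y - u) + \<gamma> / 2 * (norm s)\<^sup>2"
    using norm_add_scale_square[of "y - u" "- \<gamma>" s] gam
    by (simp add: inner_commute diff_diff_eq field_simps power2_eq_square)
  moreover have "1 / (2 * \<gamma>) * (norm (u - (u + \<gamma> *\<^sub>R s)))\<^sup>2 = \<gamma> / 2 * (norm s)\<^sup>2"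
    using gam by (simp add: power_mult_distrib power2_eq_square)
  moreover have "f u + s \<bullet> (y - u) - \<rho> / 2 * (norm (y - u))\<^sup>2 \<le> f y"
    using s unfolding weak_subgradient_def by blast
  moreover have "(1 / \<gamma> - \<rho>) / 2 * (norm (y - u))\<^sup>2
      = 1 / (2 * \<gamma>) * (norm (y - u))\<^sup>2 - \<rho> / 2 * (norm (y - u))\<^sup>2"
    by (simp add: diff_divide_distrib left_diff_distrib)
  ultimately show ?thesis by linarith
qed

lemma prox_weak_subgradient:
  fixes f :: "'a::real_inner \<Rightarrow> real"
  assumes s: "weak_subgradient \<rho> f u s" and gam: "0 < \<gamma>" "\<gamma> * \<rho> < 1"
  shows "prox \<gamma> f (u + \<gamma> *\<^sub>R s) = u"
proof -
  define F where "F y = f y + 1 / (2 * \<gamma>) * (norm (y - (u + \<gamma> *\<^sub>R s)))\<^sup>2" for y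
  define \<mu> where "\<mu> = 1 / \<gamma> - \<rho>"
  have mu: "\<mu> > 0" using gam by (simp add: field_simps \<mu>_def)
  have growth: "F u + \<mu> / 2 * (norm (y - u))\<^sup>2 \<le> F y" for y
    unfolding F_def \<mu>_def by (rule prox_growth[OF s gam(1)])
  have "arg_min F (\<lambda>_. True) = u"
    unfolding arg_min_def
  proof (rule some_equality)
    show "is_arg_min F (\<lambda>_. True) u"
      unfolding is_arg_min_linorder
    proof (intro conjI allI impI TrueI)
      fix y
      have "0 \<le> \<mu> / 2 * (norm (y - u))\<^sup>2" using mu by simp
      then show "F u \<le> F y" using growth[of y] by linarith
    qed
    fix y assume "is_arg_min F (\<lambda>_. True) y"
    then have "F y \<le> F u" unfolding is_arg_min_linorder by blast
    then have "\<mu> / 2 * (norm (y - u))\<^sup>2 \<le> 0" using growth[of y] by linarith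
    then show "y = u" using mu by (simp add: mult_le_0_iff)
  qed
  then show ?thesis unfolding prox_def F_def .
qed

lemma grad_moreau_env:
  fixes f :: "'a::real_inner \<Rightarrow> real"
  assumes s: "weak_subgradient \<rho> f u s" and gam: "0 < \<gamma>" "\<gamma> * \<rho> < 1"
  shows "grad (moreau_env \<gamma> f) (u + \<gamma> *\<^sub>R s) = s"
proof -
  let ?w = "u + \<gamma> *\<^sub>R s"
  have "GDERIV (\<lambda>z. INF y. f y + 1 / (2 * \<gamma>) * (norm (y - z))\<^sup>2) ?w :> s"
  proof (rule gderiv_INF_quadratic_growth)
    show "0 < 1 / \<gamma> - \<rho>" using gam by (simp add: field_simps)
    show "bounded_linear (\<lambda>d::'a. (- 1 / \<gamma>) *\<^sub>R d)" by (rule bounded_linear_scaleR_right)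
    show "f u + 1 / (2 * \<gamma>) * (norm (u - ?w))\<^sup>2 + (1 / \<gamma> - \<rho>) / 2 * (norm (y - u))\<^sup>2
      \<le> f y + 1 / (2 * \<gamma>) * (norm (y - ?w))\<^sup>2" for y
      by (rule prox_growth[OF s gam(1)])
    show "f y + 1 / (2 * \<gamma>) * (norm (y - (?w + \<delta>)))\<^sup>2
      = f y + 1 / (2 * \<gamma>) * (norm (y - ?w))\<^sup>2 + \<delta> \<bullet> (s + (- 1 / \<gamma>) *\<^sub>R (y - u))
        + 1 / (2 * \<gamma>) * (norm \<delta>)\<^sup>2" for y \<delta>
    proof -
      have "(norm (y - (?w + \<delta>)))\<^sup>2
          = (norm (y - ?w))\<^sup>2 + 2 * ((y - ?w) \<bullet> (- \<delta>)) + (norm \<delta>)\<^sup>2"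
        using norm_add_square[of "y - ?w" "- \<delta>"] by (simp add: diff_diff_eq)
      moreover have "(y - ?w) \<bullet> (- \<delta>) = \<gamma> * (\<delta> \<bullet> (s + (- 1 / \<gamma>) *\<^sub>R (y - u)))"
        using gam(1) by (simp add: inner_simps inner_commute field_simps)
      ultimately show ?thesis using gam(1) by (simp add: field_simps)
    qed
  qed (use gam in auto)
  then show ?thesis unfolding moreau_env_def[abs_def] by (rule grad_eqI)
qed

text \<open>Both implicit subgradient properties are about Moreau gradients at arbitrary proximal preimages.
  This lemma and the next read them as statements about weak subgradients.\<close>

lemma implicit_lipschitz_const_weak_subgradient:
  assumes L: "implicit_lipschitz_const \<gamma> f L" and gam: "0 < \<gamma>" "\<gamma> * \<rho> < 1"
    and s: "weak_subgradient \<rho> f u s" "weak_subgradient \<rho> f v t"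
  shows "norm (s - t) \<le> L * norm (u - v)"
proof -
  note p = prox_weak_subgradient[OF s(1) gam] prox_weak_subgradient[OF s(2) gam]
  have "u \<in> range (prox \<gamma> f)" "v \<in> range (prox \<gamma> f)"
    "u + \<gamma> *\<^sub>R s \<in> prox \<gamma> f -` {u}" "v + \<gamma> *\<^sub>R t \<in> prox \<gamma> f -` {v}"
    using p by (auto intro: range_eqI[OF sym])
  then have "norm (grad (moreau_env \<gamma> f) (u + \<gamma> *\<^sub>R s) - grad (moreau_env \<gamma> f) (v + \<gamma> *\<^sub>R t))
      \<le> L * norm (u - v)"
    using L unfolding implicit_lipschitz_const_def by blast
  then show ?thesis unfolding grad_moreau_env[OF s(1) gam] grad_moreau_env[OF s(2) gam] .
qed

lemma implicit_bounded_const_weak_subgradient: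
  assumes L: "implicit_bounded_const \<gamma> f L" and gam: "0 < \<gamma>" "\<gamma> * \<rho> < 1"
    and s: "weak_subgradient \<rho> f u s"
  shows "norm s \<le> L"
proof -
  note p = prox_weak_subgradient[OF s gam]
  have "u \<in> range (prox \<gamma> f)" "u + \<gamma> *\<^sub>R s \<in> prox \<gamma> f -` {u}"
    using p by (auto intro: range_eqI[OF sym])
  then have "norm (grad (moreau_env \<gamma> f) (u + \<gamma> *\<^sub>R s)) \<le> L"
    using L unfolding implicit_bounded_const_def by blast
  then show ?thesis unfolding grad_moreau_env[OF s gam] .
qed

section \<open>The proximal augmented Lagrangian\<close>

text \<open>The \<open>\<rho>\<close>-term is the defect of \<open>\<rho> / 2 \<cdot> |\<cdot>|\<^sup>2\<close> from being affine along the segment.\<close>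

lemma weakly_convex_combination:
  fixes f :: "'a::real_inner \<Rightarrow> real"
  assumes "weakly_convex \<rho> f" "0 < t" "t < 1"
  shows "f (u + t *\<^sub>R d) \<le> (1 - t) * f u + t * f (u + d) + \<rho> / 2 * (t * (1 - t)) * (norm d)\<^sup>2"
proof -
  let ?g = "\<lambda>x. f x + \<rho> / 2 * (norm x)\<^sup>2"
  have "?g ((1 - t) *\<^sub>R u + t *\<^sub>R (u + d)) \<le> (1 - t) * ?g u + t * ?g (u + d)"
    using assms unfolding weakly_convex_def by (intro convex_onD[of UNIV]) auto
  moreover have "(1 - t) *\<^sub>R u + t *\<^sub>R (u + d) = u + t *\<^sub>R d" by (simp add: algebra_simps)
  moreover have "(1 - t) * (\<rho> / 2 * (norm u)\<^sup>2) + t * (\<rho> / 2 * (norm (u + d))\<^sup>2)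
      - \<rho> / 2 * (norm (u + t *\<^sub>R d))\<^sup>2 = \<rho> / 2 * (t * (1 - t)) * (norm d)\<^sup>2"
    unfolding norm_add_square norm_add_scale_square
    by (simp add: algebra_simps power2_eq_square add_divide_distrib diff_divide_distrib)
  ultimately show ?thesis unfolding distrib_left by simp
qed

text \<open>The multiplier after a step that moved to \<open>u\<close>. It appears in the optimality condition because
  it collects the gradients of the linear and of the penalty term: their sum at \<open>u\<close> is
  \<open>A\<^sup>T (lam + \<beta> (A u - b))\<close>.\<close>

definition dual_update :: "real^'n^'m \<Rightarrow> real^'m \<Rightarrow> real \<Rightarrow> real^'m \<Rightarrow> real^'n \<Rightarrow> real^'m" where
  "dual_update A b \<beta> lam u = lam + \<beta> *\<^sub>R (A *v u - b)"

text \<open>Exact second-order expansion of everything except \<open>f\<close>, which is only known by inequalities.\<close>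

lemma prox_lagrangian_add:
  fixes A :: "real^'n^'m"
  shows "prox_lagrangian f A b \<gamma> \<beta> (u + t *\<^sub>R d) z lam
    = prox_lagrangian f A b \<gamma> \<beta> u z lam + (f (u + t *\<^sub>R d) - f u)
      + t * ((transpose A *v dual_update A b \<beta> lam u - (1 / \<gamma>) *\<^sub>R (z - u)) \<bullet> d)
      + t\<^sup>2 * (\<beta> / 2 * (norm (A *v d))\<^sup>2 + 1 / (2 * \<gamma>) * (norm d)\<^sup>2)"
proof -
  have "A *v (u + t *\<^sub>R d) - b = (A *v u - b) + t *\<^sub>R (A *v d)"
    by (simp add: matrix_vector_right_distrib matrix_vector_mult_scaleR)
  moreover have "u + t *\<^sub>R d - z = (u - z) + t *\<^sub>R d" by simp
  ultimately show ?thesis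
    unfolding prox_lagrangian_def aug_lagrangian_def dual_update_def
    by (simp only: norm_add_scale_square inner_diff_left inner_transpose_mult inner_add_left
        inner_add_right inner_scaleR_left inner_scaleR_right)
      (simp add: algebra_simps)
qed

text \<open>The optimality condition \<open>0 \<in> \<partial>P\<close> solved for the subgradient of \<open>f\<close>. Along the segment from \<open>u\<close> to
  \<open>y\<close>, weak convexity bounds the increase of \<open>f\<close> and the rest of \<open>P\<close> is quadratic, so optimality yields
  a nonnegative slope at \<open>u\<close>.\<close>

lemma prox_lagrangian_argmin_weak_subgradient:
  fixes A :: "real^'n^'m"
  assumes wcvx: "weakly_convex \<rho> f"
    and min: "is_arg_min (\<lambda>y. prox_lagrangian f A b \<gamma> \<beta> y z lam) (\<lambda>_. True) u"
  shows "weak_subgradient \<rho> f u ((1 / \<gamma>) *\<^sub>R (z - u) - transpose A *v dual_update A b \<beta> lam u)"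
    (is "weak_subgradient \<rho> f u ?s")
  unfolding weak_subgradient_def
proof
  fix y
  define d where "d = y - u"
  define Q where "Q = \<beta> / 2 * (norm (A *v d))\<^sup>2 + 1 / (2 * \<gamma>) * (norm d)\<^sup>2"
  have ud: "u + d = y" by (simp add: d_def)
  have "0 \<le> f y - f u + \<rho> / 2 * (norm d)\<^sup>2 - ?s \<bullet> d"
  proof (rule slope_nonneg_of_quadratic_nonneg)
    fix t :: real assume t: "0 < t" "t < 1"
    have "prox_lagrangian f A b \<gamma> \<beta> u z lam \<le> prox_lagrangian f A b \<gamma> \<beta> (u + t *\<^sub>R d) z lam"
      using min unfolding is_arg_min_linorder by blast
    then have "0 \<le> (f (u + t *\<^sub>R d) - f u) - t * (?s \<bullet> d) + t\<^sup>2 * Q"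
      unfolding prox_lagrangian_add Q_def by (simp add: inner_diff_left right_diff_distrib)
    then show "0 \<le> (f y - f u + \<rho> / 2 * (norm d)\<^sup>2 - ?s \<bullet> d) * t + (Q - \<rho> / 2 * (norm d)\<^sup>2) * t\<^sup>2"
      using weakly_convex_combination[OF wcvx t, of u d] unfolding ud
      by (simp add: algebra_simps power2_eq_square add_divide_distrib diff_divide_distrib)
  qed
  then show "f u + ?s \<bullet> (y - u) - \<rho> / 2 * (norm (y - u))\<^sup>2 \<le> f y" unfolding d_def by linarith
qed

lemma prox_lagrangian_growth:
  fixes A :: "real^'n^'m"
  assumes wcvx: "weakly_convex \<rho> f" and beta: "0 \<le> \<beta>"
    and min: "is_arg_min (\<lambda>y. prox_lagrangian f A b \<gamma> \<beta> y z lam) (\<lambda>_. True) u"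
  shows "prox_lagrangian f A b \<gamma> \<beta> u z lam + (1 / \<gamma> - \<rho>) / 2 * (norm (y - u))\<^sup>2
    \<le> prox_lagrangian f A b \<gamma> \<beta> y z lam"
proof -
  let ?s = "(1 / \<gamma>) *\<^sub>R (z - u) - transpose A *v dual_update A b \<beta> lam u"
  have "f u + ?s \<bullet> (y - u) - \<rho> / 2 * (norm (y - u))\<^sup>2 \<le> f y"
    using prox_lagrangian_argmin_weak_subgradient[OF wcvx min] unfolding weak_subgradient_def by blast
  moreover have "0 \<le> \<beta> / 2 * (norm (A *v (y - u)))\<^sup>2" using beta by simp
  moreover have "prox_lagrangian f A b \<gamma> \<beta> y z lam = prox_lagrangian f A b \<gamma> \<beta> u z lam + (f y - f u)
      - ?s \<bullet> (y - u) + (\<beta> / 2 * (norm (A *v (y - u)))\<^sup>2 + 1 / (2 * \<gamma>) * (norm (y - u))\<^sup>2)"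
    using prox_lagrangian_add[of f A b \<gamma> \<beta> u 1 "y - u" z lam] by (simp add: inner_diff_left)
  moreover have "(1 / \<gamma> - \<rho>) / 2 * (norm (y - u))\<^sup>2
      = 1 / (2 * \<gamma>) * (norm (y - u))\<^sup>2 - \<rho> / 2 * (norm (y - u))\<^sup>2"
    by (simp add: diff_divide_distrib left_diff_distrib)
  ultimately show ?thesis by linarith
qed

text \<open>Here \<open>\<delta> = (\<delta>z, \<delta>\<lambda>)\<close> changes the objective by \<open>\<delta>\<lambda> \<bullet> (A y - b)\<close>, by \<open>\<delta>z \<bullet> (z - y) / \<gamma>\<close> and by
  \<open>|\<delta>z|\<^sup>2 / (2 \<gamma>)\<close>, and the first two have slopes that are affine in \<open>y\<close>.\<close>

lemma grad_meal_phi: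
  fixes A :: "real^'n^'m"
  assumes wcvx: "weakly_convex \<rho> f" and beta: "0 \<le> \<beta>" and gam: "0 < \<gamma>" "\<gamma> * \<rho> < 1"
    and min: "is_arg_min (\<lambda>y. prox_lagrangian f A b \<gamma> \<beta> y z lam) (\<lambda>_. True) u"
  shows "grad (meal_phi f A b \<gamma> \<beta>) (z, lam) = ((1 / \<gamma>) *\<^sub>R (z - u), A *v u - b)"
proof -
  let ?P = "\<lambda>y p. prox_lagrangian f A b \<gamma> \<beta> y (fst p) (snd p)"
  have "GDERIV (\<lambda>q. INF y. ?P y q) (z, lam) :> ((1 / \<gamma>) *\<^sub>R (z - u), A *v u - b)"
  proof (rule gderiv_INF_quadratic_growth)
    show "0 < 1 / \<gamma> - \<rho>" using gam by (simp add: field_simps)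
    show "bounded_linear (\<lambda>d. ((- 1 / \<gamma>) *\<^sub>R d, A *v d))"
      by (intro bounded_linear_Pair bounded_linear_scaleR_right matrix_vector_mul_bounded_linear)
    show "prox_lagrangian f A b \<gamma> \<beta> u z lam + (1 / \<gamma> - \<rho>) / 2 * (norm (y - u))\<^sup>2
      \<le> prox_lagrangian f A b \<gamma> \<beta> y z lam" for y
      by (rule prox_lagrangian_growth[OF wcvx beta min])
    show "?P y ((z, lam) + \<delta>) = prox_lagrangian f A b \<gamma> \<beta> y z lam
        + \<delta> \<bullet> (((1 / \<gamma>) *\<^sub>R (z - u), A *v u - b) + ((- 1 / \<gamma>) *\<^sub>R (y - u), A *v (y - u)))
        + 1 / (2 * \<gamma>) * (norm (fst \<delta>))\<^sup>2" for y \<delta>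
    proof -
      let ?D = "(1 / \<gamma>) *\<^sub>R (z - u) + (- 1 / \<gamma>) *\<^sub>R (y - u)"
      have "(norm (y - (z + fst \<delta>)))\<^sup>2
          = (norm (y - z))\<^sup>2 + 2 * ((y - z) \<bullet> (- fst \<delta>)) + (norm (fst \<delta>))\<^sup>2"
        using norm_add_square[of "y - z" "- fst \<delta>"] by (simp add: diff_diff_eq)
      moreover have "(y - z) \<bullet> (- fst \<delta>) = \<gamma> * (fst \<delta> \<bullet> ?D)"
        using gam(1) by (simp add: inner_simps inner_commute field_simps)
      ultimately have "1 / (2 * \<gamma>) * (norm (y - (z + fst \<delta>)))\<^sup>2
          = 1 / (2 * \<gamma>) * (norm (y - z))\<^sup>2 + fst \<delta> \<bullet> ?D + 1 / (2 * \<gamma>) * (norm (fst \<delta>))\<^sup>2"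
        using gam(1) by (simp add: field_simps)
      moreover have Ay: "A *v u - b + A *v (y - u) = A *v y - b"
        by (simp add: matrix_vector_mult_diff_distrib)
      ultimately show ?thesis
        by (simp add: prox_lagrangian_def aug_lagrangian_def inner_prod_def inner_add_left Ay)
    qed
    show "norm (fst \<delta>) \<le> norm \<delta>" for \<delta> :: "(real^'n) \<times> (real^'m)"
      by (metis norm_fst_le surjective_pairing)
  qed (use gam in auto)
  then show ?thesis unfolding meal_phi_def case_prod_beta by (rule grad_eqI)
qed

section \<open>Rates from summable squares\<close>

text \<open>The minimum over \<open>{0..k}\<close> is at most each of the roughly \<open>k / 2\<close> last terms, so \<open>k / 2\<close> times its
  square is at most a tail of a convergent series.\<close>

lemma Min_smallo_inverse_sqrt:
  fixes a :: "nat \<Rightarrow> real"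
  assumes nonneg: "\<And>t. 0 \<le> a t" and sum: "summable (\<lambda>t. (a t)\<^sup>2)"
  shows "(\<lambda>k. Min (a ` {0..k})) \<in> o(\<lambda>k. 1 / sqrt (real k))"
proof -
  define m where "m k = Min (a ` {0..k})" for k
  define S where "S n = (\<Sum>t<n. (a t)\<^sup>2)" for n
  have m_le: "m k \<le> a t" if "t \<le> k" for t k
    unfolding m_def using that by (intro Min_le) auto
  have m_nonneg: "0 \<le> m k" for k
    unfolding m_def using nonneg by (subst Min_ge_iff) auto
  have half: "(m k)\<^sup>2 * real k \<le> 2 * (S (Suc k) - S (Suc k div 2))" for k
  proof -
    have "(m k)\<^sup>2 * real (Suc k - Suc k div 2) = (\<Sum>t = Suc k div 2..<Suc k. (m k)\<^sup>2)" by simp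
    also have "\<dots> \<le> (\<Sum>t = Suc k div 2..<Suc k. (a t)\<^sup>2)"
      by (intro sum_mono power_mono m_le m_nonneg) auto
    also have "\<dots> = S (Suc k) - S (Suc k div 2)"
      unfolding S_def using sum_diff_nat_ivl[of 0 "Suc k div 2" "Suc k" "\<lambda>t. (a t)\<^sup>2"]
      by (simp add: atLeast0LessThan)
    finally have *: "(m k)\<^sup>2 * real (Suc k - Suc k div 2) \<le> S (Suc k) - S (Suc k div 2)" .
    have "real k \<le> 2 * real (Suc k - Suc k div 2)" by linarith
    then have "(m k)\<^sup>2 * real k \<le> (m k)\<^sup>2 * (2 * real (Suc k - Suc k div 2))"
      by (intro mult_left_mono) auto
    also have "\<dots> = 2 * ((m k)\<^sup>2 * real (Suc k - Suc k div 2))" by (rule mult.left_commute)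
    also have "\<dots> \<le> 2 * (S (Suc k) - S (Suc k div 2))" by (rule mult_left_mono[OF *]) simp
    finally show ?thesis .
  qed
  have S: "S \<longlonglongrightarrow> suminf (\<lambda>t. (a t)\<^sup>2)" unfolding S_def by (rule summable_LIMSEQ[OF sum])
  have "filterlim (\<lambda>k. Suc k div 2) at_top sequentially"
    unfolding filterlim_at_top eventually_sequentially
    by (metis (no_types, lifting) Suc_leD div_le_mono le_SucI nonzero_mult_div_cancel_left zero_neq_numeral)
  from filterlim_compose[OF S this] have "(\<lambda>k. S (Suc k div 2)) \<longlonglongrightarrow> suminf (\<lambda>t. (a t)\<^sup>2)" .
  with LIMSEQ_Suc[OF S] have "(\<lambda>k. 2 * (S (Suc k) - S (Suc k div 2))) \<longlonglongrightarrow> 2 * (suminf (\<lambda>t. (a t)\<^sup>2) - suminf (\<lambda>t. (a t)\<^sup>2))"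
    by (intro tendsto_intros)
  then have lim0: "(\<lambda>k. 2 * (S (Suc k) - S (Suc k div 2))) \<longlonglongrightarrow> 0"
    by (simp only: diff_self mult_zero_right)
  have "(\<lambda>k. (m k)\<^sup>2 * real k) \<longlonglongrightarrow> 0"
    by (rule real_tendsto_sandwich[OF _ always_eventually[OF allI[OF half]] tendsto_const lim0])
      (simp add: always_eventually)
  then have "(\<lambda>k. sqrt ((m k)\<^sup>2 * real k)) \<longlonglongrightarrow> sqrt 0" by (rule tendsto_real_sqrt)
  then have lim: "(\<lambda>k. m k / (1 / sqrt (real k))) \<longlonglongrightarrow> 0"
    using m_nonneg by (simp add: real_sqrt_mult)
  have "eventually (\<lambda>k. 1 / sqrt (real k) \<noteq> 0) sequentially"
    using eventually_gt_at_top[of 0] by eventually_elim simp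
  with lim have "m \<in> o(\<lambda>k. 1 / sqrt (real k))" by (intro smalloI_tendsto)
  then show ?thesis unfolding m_def[abs_def] .
qed

lemma Min_le_sqrt_sum:
  fixes a :: "nat \<Rightarrow> real"
  assumes nonneg: "\<And>t. 0 \<le> a t" and sum: "(\<Sum>t=1..K. (a t)\<^sup>2) \<le> B" and K: "K \<ge> 1"
  shows "Min (a ` {0..K}) \<le> sqrt B / sqrt (real K)"
proof -
  let ?m = "Min (a ` {0..K})"
  have "?m \<le> a t" if "t \<le> K" for t using that by (intro Min_le) auto
  moreover have m: "0 \<le> ?m" using nonneg by (subst Min_ge_iff) auto
  ultimately have "(\<Sum>t=1..K. ?m\<^sup>2) \<le> (\<Sum>t=1..K. (a t)\<^sup>2)"
    by (intro sum_mono power_mono) auto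
  with sum have "?m\<^sup>2 * real K \<le> B" by (simp add: mult.commute)
  then have "sqrt (?m\<^sup>2 * real K) \<le> sqrt B" by (rule real_sqrt_le_mono)
  then show ?thesis using m K by (simp add: real_sqrt_mult field_simps)
qed

text \<open>Telescoping. The sum starts at \<open>1\<close> because the energies involve the preceding iterate.\<close>

lemma sum_le_energy_drop:
  fixes E g :: "nat \<Rightarrow> real"
  assumes "\<And>k. k \<ge> 1 \<Longrightarrow> g k + E (Suc k) \<le> E k + e"
  shows "(\<Sum>k=1..K. g k) + E (Suc K) \<le> E 1 + real K * e"
proof (induction K)
  case (Suc K)
  then show ?case using assms[of "Suc K"] by (simp add: algebra_simps)
qed simp

section \<open>Descent along a run\<close>

locale meal_run =
  fixes f :: "real^'n \<Rightarrow> real" and A :: "real^'n^'m" and b :: "real^'m" and \<rho> \<gamma> \<eta> :: real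
    and \<beta> :: "nat \<Rightarrow> real" and x z :: "nat \<Rightarrow> real^'n" and lam :: "nat \<Rightarrow> real^'m"
  assumes feasible: "\<exists>y. A *v y = b" and A_nonzero: "A \<noteq> 0"
    and wcvx: "weakly_convex \<rho> f"
    and gam: "0 < \<gamma>" "\<gamma> * \<rho> < 1" and eta: "0 < \<eta>" "\<eta> < 2"
    and seq: "meal_seq f A b \<gamma> \<eta> \<beta> x z lam"
begin

text \<open>The element of the subdifferential of \<open>f\<close> at \<open>x (Suc k)\<close> that the \<open>x\<close>-step selects.\<close>

definition subgrad :: "nat \<Rightarrow> real^'n" where
  "subgrad k = (1 / \<gamma>) *\<^sub>R (z k - x (Suc k)) - transpose A *v lam (Suc k)"

abbreviation resid :: "nat \<Rightarrow> real^'m" where "resid k \<equiv> A *v x (Suc k) - b"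
abbreviation \<alpha> :: "nat \<Rightarrow> real" where "\<alpha> \<equiv> meal_alpha A \<gamma> \<eta> \<beta>"
abbreviation P :: "nat \<Rightarrow> real" where
  "P k \<equiv> prox_lagrangian f A b \<gamma> (\<beta> k) (x k) (z k) (lam k)"
abbreviation G :: "nat \<Rightarrow> real" where
  "G k \<equiv> norm (grad (meal_phi f A b \<gamma> (\<beta> k)) (z k, lam k))"

lemma
  beta_pos: "\<beta> k > 0" and
  x_step: "is_arg_min (\<lambda>y. prox_lagrangian f A b \<gamma> (\<beta> k) y (z k) (lam k)) (\<lambda>_. True) (x (Suc k))" and
  z_step: "z (Suc k) - z k = - \<eta> *\<^sub>R (z k - x (Suc k))" and
  lam_step: "lam (Suc k) - lam k = \<beta> k *\<^sub>R resid k"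
  using seq unfolding meal_seq_def by auto

lemma weak_subgradient_subgrad: "weak_subgradient \<rho> f (x (Suc k)) (subgrad k)"
  using prox_lagrangian_argmin_weak_subgradient[OF wcvx x_step[of k]] lam_step[of k]
  unfolding subgrad_def dual_update_def by (simp add: diff_eq_eq add.commute)

lemma G_square: "(G k)\<^sup>2 = (norm (z k - x (Suc k)))\<^sup>2 / \<gamma>\<^sup>2 + (norm (resid k))\<^sup>2"
  using grad_meal_phi[OF wcvx less_imp_le[OF beta_pos] gam x_step[of k]] gam(1)
  by (simp add: norm_Pair power_divide)

lemma c_pos: "meal_c \<gamma> A > 0"
  using min_pos_eigenvalue_bound(1)[OF A_nonzero] gam(1) by (simp add: meal_c_def)

lemma alpha_pos: "\<alpha> k > 0"
  unfolding meal_alpha_def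
  using beta_pos[of k] beta_pos[of "Suc k"] c_pos gam(1) eta by (simp add: add_pos_pos)

text \<open>Since \<open>b\<close> lies in the range of \<open>A\<close>, so do the residuals, and with them the multiplier steps.\<close>

lemma dual_step_bound:
  "meal_c \<gamma> A * (norm (lam (Suc k) - lam k))\<^sup>2
    \<le> (norm (\<gamma> *\<^sub>R (transpose A *v (lam (Suc k) - lam k))))\<^sup>2"
proof -
  obtain y where "A *v y = b" using feasible by blast
  then have "lam (Suc k) - lam k = A *v (\<beta> k *\<^sub>R (x (Suc k) - y))"
    by (simp add: lam_step matrix_vector_mult_scaleR matrix_vector_mult_diff_distrib)
  then have "min_pos_eigenvalue (transpose A ** A) * (norm (lam (Suc k) - lam k))\<^sup>2
      \<le> (norm (transpose A *v (lam (Suc k) - lam k)))\<^sup>2"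
    using min_pos_eigenvalue_bound(2)[OF A_nonzero] by metis
  from mult_left_mono[OF this, of "\<gamma>\<^sup>2"] show ?thesis
    by (simp add: meal_c_def power_mult_distrib mult.assoc)
qed

text \<open>The definition of \<^const>\<open>subgrad\<close> at two consecutive indices, subtracted.\<close>

lemma dual_difference:
  "\<gamma> *\<^sub>R (transpose A *v (lam (Suc (Suc k)) - lam (Suc k)))
    = (z (Suc k) - z k) + (x (Suc k) - x (Suc (Suc k))) + \<gamma> *\<^sub>R (subgrad k - subgrad (Suc k))"
  using gam(1)
  by (simp add: subgrad_def matrix_vector_mult_diff_distrib algebra_simps)

text \<open>The effect of the \<open>z\<close>-, \<open>\<lambda>\<close>- and penalty updates. The \<open>z\<close>-step shrinks the distance
  to \<open>x (Suc k)\<close> by the factor \<open>|1 - \<eta>|\<close>. The multiplier step adds \<open>\<beta> k |resid k|\<^sup>2\<close> and the change of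
  penalty \<open>(\<beta> (Suc k) - \<beta> k) / 2 \<cdot> |resid k|\<^sup>2\<close>.\<close>

lemma P_update:
  "P (Suc k) = prox_lagrangian f A b \<gamma> (\<beta> k) (x (Suc k)) (z k) (lam k)
    - (2 / \<eta> - 1) / (2 * \<gamma>) * (norm (z (Suc k) - z k))\<^sup>2
    + (\<beta> k + \<beta> (Suc k)) / 2 * (norm (resid k))\<^sup>2"
proof -
  let ?d = "z k - x (Suc k)"
  have "x (Suc k) - z (Suc k) = (\<eta> - 1) *\<^sub>R ?d"
    using z_step[of k] by (simp add: algebra_simps)
  then have "(norm (x (Suc k) - z (Suc k)))\<^sup>2 = (\<eta> - 1)\<^sup>2 * (norm ?d)\<^sup>2"
    by (simp add: power_mult_distrib)
  moreover have "(norm (z (Suc k) - z k))\<^sup>2 = \<eta>\<^sup>2 * (norm ?d)\<^sup>2"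
    by (simp add: z_step power_mult_distrib)
  moreover have "1 / (2 * \<gamma>) * ((\<eta> - 1)\<^sup>2 * D)
      = 1 / (2 * \<gamma>) * D - (2 / \<eta> - 1) / (2 * \<gamma>) * (\<eta>\<^sup>2 * D)" for D
    using gam(1) eta(1) by (simp add: field_simps power2_eq_square)
  ultimately have "1 / (2 * \<gamma>) * (norm (x (Suc k) - z (Suc k)))\<^sup>2
      = 1 / (2 * \<gamma>) * (norm (x (Suc k) - z k))\<^sup>2
        - (2 / \<eta> - 1) / (2 * \<gamma>) * (norm (z (Suc k) - z k))\<^sup>2"
    by (simp only: norm_minus_commute[of "x (Suc k)" "z k"])
  moreover have "lam (Suc k) \<bullet> resid k = lam k \<bullet> resid k + \<beta> k * (norm (resid k))\<^sup>2"
    using arg_cong[OF lam_step[of k], of "\<lambda>v. v \<bullet> resid k"]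
    by (simp add: inner_diff_left power2_norm_eq_inner)
  ultimately show ?thesis
    by (simp add: prox_lagrangian_def aug_lagrangian_def algebra_simps add_divide_distrib)
qed

text \<open>This identity is the reason for the shape of \<open>\<alpha>\<close>: its summand \<open>\<gamma> \<eta> (1 - \<eta> / 2)\<close> leaves a
  negative multiple of \<open>|resid k|\<^sup>2\<close>, which is the \<open>\<lambda>\<close>-part of the squared gradient of \<open>\<phi>\<close>.\<close>

lemma penalty_term:
  "(\<beta> k + \<beta> (Suc k)) / 2 * (norm (resid k))\<^sup>2
    = \<alpha> k * (meal_c \<gamma> A * (norm (lam (Suc k) - lam k))\<^sup>2)
      - \<gamma> * \<eta> * (1 - \<eta> / 2) / 2 * (norm (resid k))\<^sup>2"
proof -
  have "\<alpha> k * (meal_c \<gamma> A * (\<beta> k)\<^sup>2) = (\<beta> k + \<beta> (Suc k) + \<gamma> * \<eta> * (1 - \<eta> / 2)) / 2"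
    using beta_pos[of k] c_pos by (simp add: meal_alpha_def)
  then have "\<alpha> k * (meal_c \<gamma> A * (norm (lam (Suc k) - lam k))\<^sup>2)
      = (\<beta> k + \<beta> (Suc k) + \<gamma> * \<eta> * (1 - \<eta> / 2)) / 2 * (norm (resid k))\<^sup>2"
    by (simp only: lam_step norm_scaleR power_mult_distrib power2_abs mult.assoc[symmetric])
  then show ?thesis unfolding add_divide_distrib distrib_right by linarith
qed

text \<open>Half of the gain of the \<open>z\<close>-step is the \<open>z\<close>-part of the squared gradient of \<open>\<phi>\<close> with the same factor
  that \<open>penalty_term\<close> provides for its \<open>\<lambda>\<close>-part. The other half is kept to absorb the multiplier term.\<close>

lemma P_descent:
  "P (Suc k) + (1 / \<gamma> - \<rho>) / 2 * (norm (x (Suc k) - x k))\<^sup>2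
      + (2 / \<eta> - 1) / (4 * \<gamma>) * (norm (z (Suc k) - z k))\<^sup>2
      + \<gamma> * \<eta> * (1 - \<eta> / 2) / 2 * (G k)\<^sup>2
    \<le> P k + \<alpha> k * (meal_c \<gamma> A * (norm (lam (Suc k) - lam k))\<^sup>2)"
proof -
  have "(norm (z (Suc k) - z k))\<^sup>2 = \<eta>\<^sup>2 * (norm (z k - x (Suc k)))\<^sup>2"
    by (simp add: z_step power_mult_distrib)
  then have "(2 / \<eta> - 1) / (2 * \<gamma>) * (norm (z (Suc k) - z k))\<^sup>2
      = (2 / \<eta> - 1) / (4 * \<gamma>) * (norm (z (Suc k) - z k))\<^sup>2
        + \<gamma> * \<eta> * (1 - \<eta> / 2) / 2 * ((norm (z k - x (Suc k)))\<^sup>2 / \<gamma>\<^sup>2)"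
    using gam(1) eta(1) by (simp add: field_simps power2_eq_square)
  moreover have "prox_lagrangian f A b \<gamma> (\<beta> k) (x (Suc k)) (z k) (lam k)
      + (1 / \<gamma> - \<rho>) / 2 * (norm (x (Suc k) - x k))\<^sup>2 \<le> P k"
    using prox_lagrangian_growth[OF wcvx less_imp_le[OF beta_pos] x_step, of k "x k"]
    by (simp add: norm_minus_commute)
  \<comment> \<open>The two occurrences of \<open>R\<close>, the \<open>\<lambda>\<close>-part of the squared gradient, cancel, and \<open>Z\<close>, its
    \<open>z\<close>-part, is the second half of the gain \<open>q\<close>.\<close>
  moreover have "p - q + (d - R) + X + h + (Z + R) \<le> p' + d" if "q = h + Z" "p + X \<le> p'"
    for p q d R X h Z p' :: real
    using that by linarith
  ultimately show ?thesis unfolding P_update G_square penalty_term distrib_left by blast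
qed

abbreviation E :: "nat \<Rightarrow> real" where "E \<equiv> meal_energy f A b \<gamma> \<eta> \<beta> x z lam"
abbreviation E' :: "nat \<Rightarrow> real" where "E' \<equiv> meal_energy_tilde f A b \<gamma> \<eta> \<beta> x z lam"

text \<open>With Lipschitz subgradients \<open>\<gamma> |A\<^sup>T (\<lambda>\<^sup>k\<^sup>+\<^sup>1 - \<lambda>\<^sup>k)|\<close> is at most \<open>(1 + \<gamma> L)\<close> times the move of \<open>x\<close> plus
  the previous move of \<open>z\<close>. Its square is paid for by the \<open>x\<close>-step, this is the first bound on \<open>a\<close>, and
  by the term \<open>2 a |z\<^sup>k - z\<^sup>k\<^sup>-\<^sup>1|\<^sup>2\<close> of the energy, whose successor is paid for by the \<open>z\<close>-step, the
  second bound on \<open>a\<close>.\<close>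

lemma energy_descent:
  assumes L: "implicit_lipschitz_const \<gamma> f L"
    and const: "\<And>k. \<alpha> k = a"
    and a: "a \<le> (1 - \<gamma> * \<rho>) / (4 * \<gamma> * (1 + \<gamma> * L)\<^sup>2)" "a \<le> 1 / (8 * \<gamma>) * (2 / \<eta> - 1)"
    and k: "k \<ge> 1"
  shows "\<gamma> * \<eta> * (1 - \<eta> / 2) / 2 * (G k)\<^sup>2 + E (Suc k) \<le> E k"
proof -
  obtain j where j: "k = Suc j" using k by (cases k) auto
  have L0: "L > 0" using L by (simp add: implicit_lipschitz_const_def)
  let ?dx = "norm (x (Suc k) - x k)" and ?dz = "norm (z k - z j)"
  have ap: "a > 0" using alpha_pos[of 0] const by simp
  have "norm (subgrad j - subgrad k) \<le> L * ?dx"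
    using implicit_lipschitz_const_weak_subgradient[OF L gam weak_subgradient_subgrad weak_subgradient_subgrad, of j k]
    by (simp add: j norm_minus_commute)
  then have ds: "norm (\<gamma> *\<^sub>R (subgrad j - subgrad k)) \<le> \<gamma> * L * ?dx" using gam(1) by simp
  have "norm (\<gamma> *\<^sub>R (transpose A *v (lam (Suc k) - lam k))) \<le> ?dz + ?dx + norm (\<gamma> *\<^sub>R (subgrad j - subgrad k))"
    unfolding j dual_difference
    using norm_triangle_ineq[of "z (Suc j) - z j + (x (Suc j) - x (Suc (Suc j)))" "\<gamma> *\<^sub>R (subgrad j - subgrad (Suc j))"]
      norm_triangle_ineq[of "z (Suc j) - z j" "x (Suc j) - x (Suc (Suc j))"]
    by (simp add: norm_minus_commute[of "x (Suc j)"])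
  with ds have "norm (\<gamma> *\<^sub>R (transpose A *v (lam (Suc k) - lam k))) \<le> ?dz + (1 + \<gamma> * L) * ?dx"
    by (simp add: algebra_simps)
  then have "(norm (\<gamma> *\<^sub>R (transpose A *v (lam (Suc k) - lam k))))\<^sup>2 \<le> (?dz + (1 + \<gamma> * L) * ?dx)\<^sup>2"
    by (intro power_mono) auto
  also have "\<dots> \<le> 2 * ?dz\<^sup>2 + 2 * (1 + \<gamma> * L)\<^sup>2 * ?dx\<^sup>2"
    using real_sum2_square_le[of ?dz "(1 + \<gamma> * L) * ?dx"] by (simp add: power_mult_distrib)
  finally have "meal_c \<gamma> A * (norm (lam (Suc k) - lam k))\<^sup>2 \<le> 2 * ?dz\<^sup>2 + 2 * (1 + \<gamma> * L)\<^sup>2 * ?dx\<^sup>2"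
    using dual_step_bound[of k] by linarith
  from mult_left_mono[OF this, of a]
  have dual: "a * (meal_c \<gamma> A * (norm (lam (Suc k) - lam k))\<^sup>2)
      \<le> 2 * a * ?dz\<^sup>2 + 2 * a * (1 + \<gamma> * L)\<^sup>2 * ?dx\<^sup>2"
    using ap by (simp add: algebra_simps)
  have "4 * \<gamma> * (1 + \<gamma> * L)\<^sup>2 > 0" using gam(1) L0
    by (intro mult_pos_pos zero_less_power add_pos_pos) auto
  then have "2 * a * (1 + \<gamma> * L)\<^sup>2 \<le> (1 / \<gamma> - \<rho>) / 2"
    using a(1) gam(1) by (simp add: pos_le_divide_eq) (simp add: field_simps)
  then have cx: "2 * a * (1 + \<gamma> * L)\<^sup>2 * ?dx\<^sup>2 \<le> (1 / \<gamma> - \<rho>) / 2 * ?dx\<^sup>2"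
    by (rule mult_right_mono) simp
  have "2 * a \<le> (2 / \<eta> - 1) / (4 * \<gamma>)" using quarter_coefficient[OF a(2)] by simp
  then have cz: "2 * a * (norm (z (Suc k) - z k))\<^sup>2 \<le> (2 / \<eta> - 1) / (4 * \<gamma>) * (norm (z (Suc k) - z k))\<^sup>2"
    by (rule mult_right_mono) simp
  have "E k = P k + 2 * a * ?dz\<^sup>2" "E (Suc k) = P (Suc k) + 2 * a * (norm (z (Suc k) - z k))\<^sup>2"
    by (simp_all add: meal_energy_def const j)
  then show ?thesis using P_descent[of k] dual cx cz unfolding const by linarith
qed

text \<open>As before, but the difference of the subgradients is only known to be at most \<open>2 L\<close>. It is
  kept as a third summand, hence the factors \<open>3\<close>, and causes the error \<open>3 a \<gamma>\<^sup>2 (2 L)\<^sup>2\<close>.\<close>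

lemma energy_tilde_descent:
  assumes L: "implicit_bounded_const \<gamma> f L"
    and const: "\<And>k. \<alpha> k = a"
    and a: "a \<le> (1 - \<rho> * \<gamma>) / (6 * \<gamma>)" "a \<le> 1 / (12 * \<gamma>) * (2 / \<eta> - 1)"
    and k: "k \<ge> 1"
  shows "\<gamma> * \<eta> * (1 - \<eta> / 2) / 2 * (G k)\<^sup>2 + E' (Suc k) \<le> E' k + 12 * \<gamma>\<^sup>2 * L\<^sup>2 * a"
proof -
  obtain j where j: "k = Suc j" using k by (cases k) auto
  let ?dx = "norm (x (Suc k) - x k)" and ?dz = "norm (z k - z j)"
  have ap: "a > 0" using alpha_pos[of 0] const by simp
  note bound = implicit_bounded_const_weak_subgradient[OF L gam weak_subgradient_subgrad]
  have "norm (subgrad j - subgrad k) \<le> 2 * L"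
    using norm_triangle_ineq4[of "subgrad j" "subgrad k"] bound[of j] bound[of k] by linarith
  then have "(norm (subgrad j - subgrad k))\<^sup>2 \<le> (2 * L)\<^sup>2" by (intro power_mono) auto
  from mult_left_mono[OF this, of "\<gamma>\<^sup>2"]
  have ds: "(norm (\<gamma> *\<^sub>R (subgrad j - subgrad k)))\<^sup>2 \<le> 4 * \<gamma>\<^sup>2 * L\<^sup>2" by (simp add: power_mult_distrib)
  have "(norm (\<gamma> *\<^sub>R (transpose A *v (lam (Suc k) - lam k))))\<^sup>2
      \<le> 3 * ?dz\<^sup>2 + 3 * ?dx\<^sup>2 + 3 * (norm (\<gamma> *\<^sub>R (subgrad j - subgrad k)))\<^sup>2"
    using norm_sum3_square_le[of "z k - z j" "x k - x (Suc k)" "\<gamma> *\<^sub>R (subgrad j - subgrad k)"]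
    unfolding j dual_difference by (simp add: norm_minus_commute)
  with ds dual_step_bound[of k]
  have "meal_c \<gamma> A * (norm (lam (Suc k) - lam k))\<^sup>2 \<le> 3 * ?dz\<^sup>2 + 3 * ?dx\<^sup>2 + 12 * \<gamma>\<^sup>2 * L\<^sup>2"
    by linarith
  from mult_left_mono[OF this, of a]
  have dual: "a * (meal_c \<gamma> A * (norm (lam (Suc k) - lam k))\<^sup>2)
      \<le> 3 * a * ?dz\<^sup>2 + 3 * a * ?dx\<^sup>2 + 12 * \<gamma>\<^sup>2 * L\<^sup>2 * a"
    using ap by (simp add: algebra_simps)
  have "3 * a \<le> (1 / \<gamma> - \<rho>) / 2" using a(1) gam(1) by (simp add: field_simps)
  then have cx: "3 * a * ?dx\<^sup>2 \<le> (1 / \<gamma> - \<rho>) / 2 * ?dx\<^sup>2" by (rule mult_right_mono) simp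
  have "3 * a \<le> (2 / \<eta> - 1) / (4 * \<gamma>)" using quarter_coefficient[OF a(2)] by simp
  then have cz: "3 * a * (norm (z (Suc k) - z k))\<^sup>2 \<le> (2 / \<eta> - 1) / (4 * \<gamma>) * (norm (z (Suc k) - z k))\<^sup>2"
    by (rule mult_right_mono) simp
  have "E' k = P k + 3 * a * ?dz\<^sup>2" "E' (Suc k) = P (Suc k) + 3 * a * (norm (z (Suc k) - z k))\<^sup>2"
    by (simp_all add: meal_energy_tilde_def const j)
  then show ?thesis using P_descent[of k] dual cx cz unfolding const by linarith
qed

text \<open>The optimality condition of the first step is tested with \<open>d = x 1 - y\<close> for a feasible \<open>y\<close>.
  Then \<open>A d\<close> is the residual, so the penalty contributes \<open>\<gamma> \<beta> 0 |resid 0|\<^sup>2 \<ge> 0\<close> and can be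
  dropped; this is why \<open>\<beta> 0\<close> does not occur in the bound.\<close>

lemma first_iterate_bound:
  assumes y: "A *v y = b" and s: "norm (subgrad 0) \<le> L"
  shows "norm (x 1 - y) \<le> \<gamma> * (L + norm (transpose A *v lam 0)) + norm (y - z 0)"
proof -
  define d where "d = x 1 - y"
  have Ad: "A *v d = resid 0" using y by (simp add: d_def matrix_vector_mult_diff_distrib)
  have l1: "lam 1 = lam 0 + \<beta> 0 *\<^sub>R resid 0" using lam_step[of 0] by (simp add: diff_eq_eq add.commute)
  have "\<gamma> *\<^sub>R subgrad 0 = z 0 - x 1 - \<gamma> *\<^sub>R (transpose A *v lam 1)"
    using gam(1) by (simp add: subgrad_def algebra_simps)
  then have "(\<gamma> *\<^sub>R subgrad 0) \<bullet> d = (z 0 - x 1 - \<gamma> *\<^sub>R (transpose A *v lam 1)) \<bullet> d" by simp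
  also have "\<dots> = (z 0 - y) \<bullet> d - d \<bullet> d - \<gamma> * ((transpose A *v lam 0) \<bullet> d) - \<gamma> * (\<beta> 0 * (resid 0 \<bullet> resid 0))"
  proof -
    have "z 0 - x 1 = (z 0 - y) - d" by (simp add: d_def)
    moreover have "(transpose A *v lam 1) \<bullet> d = (transpose A *v lam 0) \<bullet> d + \<beta> 0 * (resid 0 \<bullet> resid 0)"
      unfolding inner_transpose_mult Ad l1 by (simp only: inner_add_left inner_scaleR_left)
    ultimately show ?thesis
      by (simp only: inner_diff_left inner_scaleR_left distrib_left)
  qed
  finally have "d \<bullet> d + \<gamma> * (\<beta> 0 * (resid 0 \<bullet> resid 0))
      = (z 0 - y - \<gamma> *\<^sub>R (transpose A *v lam 0) - \<gamma> *\<^sub>R subgrad 0) \<bullet> d"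
    by (simp add: inner_simps)
  moreover have "0 \<le> \<gamma> * (\<beta> 0 * (resid 0 \<bullet> resid 0))" using gam(1) beta_pos[of 0] by simp
  moreover have "(z 0 - y - \<gamma> *\<^sub>R (transpose A *v lam 0) - \<gamma> *\<^sub>R subgrad 0) \<bullet> d
      \<le> norm (z 0 - y - \<gamma> *\<^sub>R (transpose A *v lam 0) - \<gamma> *\<^sub>R subgrad 0) * norm d"
    by (rule norm_cauchy_schwarz)
  ultimately have "norm d * norm d \<le> norm (z 0 - y - \<gamma> *\<^sub>R (transpose A *v lam 0) - \<gamma> *\<^sub>R subgrad 0) * norm d"
    by (simp add: power2_norm_eq_inner[symmetric] power2_eq_square)
  then have "norm d \<le> norm (z 0 - y - \<gamma> *\<^sub>R (transpose A *v lam 0) - \<gamma> *\<^sub>R subgrad 0)"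
    by (cases "d = 0") simp_all
  also have "\<dots> \<le> norm (z 0 - y) + norm (\<gamma> *\<^sub>R (transpose A *v lam 0)) + norm (\<gamma> *\<^sub>R subgrad 0)"
    using norm_triangle_ineq4[of "z 0 - y - \<gamma> *\<^sub>R (transpose A *v lam 0)" "\<gamma> *\<^sub>R subgrad 0"]
      norm_triangle_ineq4[of "z 0 - y" "\<gamma> *\<^sub>R (transpose A *v lam 0)"] by linarith
  also have "\<dots> \<le> norm (y - z 0) + \<gamma> * norm (transpose A *v lam 0) + \<gamma> * L"
    using gam(1) s by (simp add: norm_minus_commute)
  finally show ?thesis by (simp add: d_def algebra_simps)
qed

text \<open>The first step decreases the proximal Lagrangian below its value at a feasible \<open>y\<close>, which
  is free of \<open>\<beta>\<close> and \<open>\<lambda>\<close>. The gain of the \<open>z\<close>-step covers the extra term of the energy, and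
  \<open>penalty_term\<close> bounds the remaining penalty terms by the squared multiplier step, which is
  controlled by \<open>first_iterate_bound\<close>.\<close>

lemma energy_tilde_first_bound:
  assumes y: "A *v y = b" and L: "implicit_bounded_const \<gamma> f L"
    and const: "\<And>k. \<alpha> k = a"
    and a: "a \<le> 1 / (12 * \<gamma>) * (2 / \<eta> - 1)"
  shows "E' 1 \<le> f y + 1 / (2 * \<gamma>) * (norm (y - z 0))\<^sup>2
    + a * (2 * \<gamma> * (L + norm (transpose A *v lam 0)) + 2 * norm (y - z 0))\<^sup>2"
proof -
  have s: "norm (subgrad 0) \<le> L"
    by (rule implicit_bounded_const_weak_subgradient[OF L gam weak_subgradient_subgrad])
  have ap: "a > 0" using alpha_pos[of 0] const by simp
  let ?M = "2 * \<gamma> * (L + norm (transpose A *v lam 0)) + 2 * norm (y - z 0)"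
  have "\<gamma> *\<^sub>R (transpose A *v (lam 1 - lam 0))
      = (z 0 - y) - (x 1 - y) - \<gamma> *\<^sub>R subgrad 0 - \<gamma> *\<^sub>R (transpose A *v lam 0)"
    using gam(1) by (simp add: subgrad_def matrix_vector_mult_diff_distrib algebra_simps)
  also have "norm \<dots> \<le> norm (z 0 - y) + norm (x 1 - y) + norm (\<gamma> *\<^sub>R subgrad 0) + norm (\<gamma> *\<^sub>R (transpose A *v lam 0))"
    using norm_triangle_ineq4[of "z 0 - y - (x 1 - y) - \<gamma> *\<^sub>R subgrad 0" "\<gamma> *\<^sub>R (transpose A *v lam 0)"]
      norm_triangle_ineq4[of "z 0 - y - (x 1 - y)" "\<gamma> *\<^sub>R subgrad 0"]
      norm_triangle_ineq4[of "z 0 - y" "x 1 - y"] by linarith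
  also have "\<dots> \<le> norm (z 0 - y) + norm (x 1 - y) + \<gamma> * L + \<gamma> * norm (transpose A *v lam 0)"
    using gam(1) s by simp
  also have "\<dots> \<le> ?M"
    using first_iterate_bound[OF y s] by (simp add: norm_minus_commute algebra_simps)
  finally have "(norm (\<gamma> *\<^sub>R (transpose A *v (lam 1 - lam 0))))\<^sup>2 \<le> ?M\<^sup>2"
    by (intro power_mono) auto
  then have "meal_c \<gamma> A * (norm (lam 1 - lam 0))\<^sup>2 \<le> ?M\<^sup>2" using dual_step_bound[of 0] by simp
  then have dual: "a * (meal_c \<gamma> A * (norm (lam 1 - lam 0))\<^sup>2) \<le> a * ?M\<^sup>2"
    using ap by simp
  have min: "prox_lagrangian f A b \<gamma> (\<beta> 0) (x 1) (z 0) (lam 0) \<le> prox_lagrangian f A b \<gamma> (\<beta> 0) y (z 0) (lam 0)"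
    using x_step[of 0] unfolding is_arg_min_linorder by simp
  have feas: "prox_lagrangian f A b \<gamma> (\<beta> 0) y (z 0) (lam 0) = f y + 1 / (2 * \<gamma>) * (norm (y - z 0))\<^sup>2"
    by (simp add: prox_lagrangian_def aug_lagrangian_def y)
  have "(2 / \<eta> - 1) / (2 * \<gamma>) \<ge> 3 * a"
  proof -
    have "3 * a \<le> (2 / \<eta> - 1) / (4 * \<gamma>)" using quarter_coefficient[OF a] by simp
    also have "\<dots> \<le> (2 / \<eta> - 1) / (2 * \<gamma>)"
      using gam(1) eta by (intro divide_left_mono) auto
    finally show ?thesis .
  qed
  then have cz: "3 * a * (norm (z 1 - z 0))\<^sup>2 \<le> (2 / \<eta> - 1) / (2 * \<gamma>) * (norm (z 1 - z 0))\<^sup>2"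
    by (rule mult_right_mono) simp
  have "0 \<le> \<gamma> * \<eta> * (1 - \<eta> / 2) / 2 * (norm (resid 0))\<^sup>2" using gam(1) eta by simp
  moreover have "E' 1 = P 1 + 3 * a * (norm (z 1 - z 0))\<^sup>2" by (simp add: meal_energy_tilde_def const)
  moreover note P_update[of 0] penalty_term[of 0]
  ultimately show ?thesis using dual min feas cz unfolding const One_nat_def by linarith
qed

lemma stationarity_smallo:
  assumes L: "implicit_lipschitz_const \<gamma> f L"
    and const: "\<And>k. \<alpha> k = a"
    and a: "a \<le> (1 - \<gamma> * \<rho>) / (4 * \<gamma> * (1 + \<gamma> * L)\<^sup>2)" "a \<le> 1 / (8 * \<gamma>) * (2 / \<eta> - 1)"
    and bdd: "bdd_below (E ` {1..})"
  shows "meal_xi f A b \<gamma> \<beta> z lam \<in> o(\<lambda>k. 1 / sqrt (real k))"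
proof -
  define C where "C = \<gamma> * \<eta> * (1 - \<eta> / 2) / 2"
  have C: "C > 0" using gam eta by (simp add: C_def)
  have descent: "C * (G k)\<^sup>2 + E (Suc k) \<le> E k + 0" if "k \<ge> 1" for k
    using energy_descent[OF L const a that] unfolding C_def by simp
  obtain m where m: "\<And>k. k \<ge> 1 \<Longrightarrow> m \<le> E k" using bdd unfolding bdd_below_def by auto
  have "summable (\<lambda>k. C * (G (Suc k))\<^sup>2)"
  proof (rule summableI_nonneg_bounded)
    fix n
    have "(\<Sum>k=1..n. C * (G k)\<^sup>2) + E (Suc n) \<le> E 1 + real n * 0"
      by (rule sum_le_energy_drop[of "\<lambda>k. C * (G k)\<^sup>2" E, OF descent])
    moreover have "(\<Sum>k=1..n. C * (G k)\<^sup>2) = (\<Sum>k<n. C * (G (Suc k))\<^sup>2)"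
      by (rule sum.reindex_bij_witness[of _ Suc "\<lambda>k. k - 1"]) auto
    ultimately show "(\<Sum>k<n. C * (G (Suc k))\<^sup>2) \<le> E 1 - m" using m[of "Suc n"] by simp
  qed (use C in simp)
  then have "summable (\<lambda>k. (G (Suc k))\<^sup>2)" using C by (simp add: summable_cmult_iff)
  then have "summable (\<lambda>k. (G k)\<^sup>2)" using summable_Suc_iff[of "\<lambda>k. (G k)\<^sup>2"] by blast
  then show ?thesis
    unfolding meal_xi_def[abs_def] by (intro Min_smallo_inverse_sqrt) auto
qed

text \<open>The expression that \<open>D\<close> bounds depends only on \<open>y\<close>, the starting point and constants, so that one
  \<open>D\<close> serves for every \<open>K\<close> and all penalty parameters at once.\<close>

lemma stationarity_bound:
  assumes y: "A *v y = b" and L: "implicit_bounded_const \<gamma> f L"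
    and K: "K \<ge> 1" and const: "\<And>k. \<alpha> k = a / real K"
    and a: "0 < a" "a \<le> (1 - \<rho> * \<gamma>) / (6 * \<gamma>)" "a \<le> 1 / (12 * \<gamma>) * (2 / \<eta> - 1)"
    and low: "\<And>k. k \<ge> 1 \<Longrightarrow> m \<le> E' k"
    and D: "f y + 1 / (2 * \<gamma>) * (norm (y - z 0))\<^sup>2
      + a * (2 * \<gamma> * (L + norm (transpose A *v lam 0)) + 2 * norm (y - z 0))\<^sup>2
      + 12 * \<gamma>\<^sup>2 * L\<^sup>2 * a - m \<le> D"
  shows "meal_xi f A b \<gamma> \<beta> z lam K \<le> sqrt (D / (\<gamma> * \<eta> * (1 - \<eta> / 2) / 2)) / sqrt (real K)"
proof -
  define C where "C = \<gamma> * \<eta> * (1 - \<eta> / 2) / 2"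
  have C: "C > 0" using gam eta by (simp add: C_def)
  define M where "M = 2 * \<gamma> * (L + norm (transpose A *v lam 0)) + 2 * norm (y - z 0)"
  have le: "a / real K \<le> a" using a(1) K by (simp add: divide_le_eq mult_le_cancel_left1)
  then have aK: "a / real K \<le> (1 - \<rho> * \<gamma>) / (6 * \<gamma>)" "a / real K \<le> 1 / (12 * \<gamma>) * (2 / \<eta> - 1)"
    using a by linarith+
  have "C * (G k)\<^sup>2 + E' (Suc k) \<le> E' k + 12 * \<gamma>\<^sup>2 * L\<^sup>2 * (a / real K)" if "k \<ge> 1" for k
    unfolding C_def by (rule energy_tilde_descent[OF L const aK that])
  from sum_le_energy_drop[of "\<lambda>k. C * (G k)\<^sup>2" E', OF this, of K]
  have "(\<Sum>k=1..K. C * (G k)\<^sup>2) + E' (Suc K) \<le> E' 1 + 12 * \<gamma>\<^sup>2 * L\<^sup>2 * a"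
    using K by simp
  moreover have "E' 1 \<le> f y + 1 / (2 * \<gamma>) * (norm (y - z 0))\<^sup>2 + a / real K * M\<^sup>2"
    using energy_tilde_first_bound[OF y L const aK(2)] unfolding M_def .
  moreover have "a / real K * M\<^sup>2 \<le> a * M\<^sup>2" using le by (rule mult_right_mono) simp
  moreover have "m \<le> E' (Suc K)" using low by simp
  ultimately have "(\<Sum>k=1..K. C * (G k)\<^sup>2) \<le> D" using D unfolding M_def[symmetric] by linarith
  then have "(\<Sum>k=1..K. (G k)\<^sup>2) \<le> D / C"
    using C by (simp add: sum_distrib_left[symmetric] field_simps)
  then show ?thesis
    unfolding meal_xi_def C_def by (intro Min_le_sqrt_sum K) auto
qed

end

section \<open>The convergence rates\<close>

theorem theorem1:
  fixes f :: "real^'n \<Rightarrow> real" and A :: "real^'n^'m" and b :: "real^'m"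
    and \<rho> \<gamma> \<eta> :: real
  assumes feasible: "{x. A *v x = b} \<noteq> {}"
    and A_nonzero: "A \<noteq> 0"
    and lsc: "lower_semicont f"
    and rho_pos: "\<rho> > 0"
    and wcvx: "weakly_convex \<rho> f"
    and gamma: "\<gamma> \<in> {0<..<1 / \<rho>}"
    and eta: "\<eta> \<in> {0<..<2}"
  shows
    "(\<forall>(\<beta>::real) (L\<^sub>f::real) x z lam.
        meal_seq f A b \<gamma> \<eta> (\<lambda>_. \<beta>) x z lam \<longrightarrow>
        (2 * \<beta> + \<gamma> * \<eta> * (1 - \<eta> / 2)) / (2 * meal_c \<gamma> A * \<beta>^2)
          < min ((1 - \<gamma> * \<rho>) / (4 * \<gamma> * (1 + \<gamma> * L\<^sub>f)^2)) (1 / (8 * \<gamma>) * (2 / \<eta> - 1)) \<longrightarrow>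
        implicit_lipschitz_subgradient \<rho> f \<longrightarrow>
        implicit_lipschitz_const \<gamma> f L\<^sub>f \<longrightarrow>
        bdd_below (meal_energy f A b \<gamma> \<eta> (\<lambda>_. \<beta>) x z lam ` {1..}) \<longrightarrow>
        (\<lambda>k. meal_xi f A b \<gamma> (\<lambda>_. \<beta>) z lam k) \<in> o(\<lambda>k. 1 / sqrt (real k)))
     \<and>
     (\<forall>(\<alpha>'::real) (Lhat\<^sub>f::real) z\<^sub>0 lam\<^sub>0 (E_low::real).
        0 < \<alpha>' \<longrightarrow>
        \<alpha>' \<le> min ((1 - \<rho> * \<gamma>) / (6 * \<gamma>)) (1 / (12 * \<gamma>) * (2 / \<eta> - 1)) \<longrightarrow>
        implicit_bounded_subgradient \<rho> f \<longrightarrow>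
        implicit_bounded_const \<gamma> f Lhat\<^sub>f \<longrightarrow>
        (\<exists>c>0. \<forall>K\<ge>1. \<forall>\<beta> x z lam.
           meal_seq f A b \<gamma> \<eta> \<beta> x z lam \<longrightarrow>
           z 0 = z\<^sub>0 \<longrightarrow> lam 0 = lam\<^sub>0 \<longrightarrow>
           (\<forall>k. meal_alpha A \<gamma> \<eta> \<beta> k = \<alpha>' / real K) \<longrightarrow>
           (\<forall>k\<ge>1. E_low \<le> meal_energy_tilde f A b \<gamma> \<eta> \<beta> x z lam k) \<longrightarrow>
           meal_xi f A b \<gamma> \<beta> z lam K \<le> c / sqrt (real K)))"
proof (intro conjI allI impI)
  have gam: "0 < \<gamma>" "\<gamma> * \<rho> < 1" using gamma rho_pos by (auto simp: field_simps)
  have et: "0 < \<eta>" "\<eta> < 2" using eta by auto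
  have run: "meal_run f A b \<rho> \<gamma> \<eta> \<beta> x z lam" if "meal_seq f A b \<gamma> \<eta> \<beta> x z lam" for \<beta> x z lam
    using that feasible A_nonzero wcvx gam et by unfold_locales auto
  {
    fix \<beta> L\<^sub>f :: real and x z lam
    assume seq: "meal_seq f A b \<gamma> \<eta> (\<lambda>_. \<beta>) x z lam"
      and small: "(2 * \<beta> + \<gamma> * \<eta> * (1 - \<eta> / 2)) / (2 * meal_c \<gamma> A * \<beta>^2)
          < min ((1 - \<gamma> * \<rho>) / (4 * \<gamma> * (1 + \<gamma> * L\<^sub>f)^2)) (1 / (8 * \<gamma>) * (2 / \<eta> - 1))"
      and L: "implicit_lipschitz_const \<gamma> f L\<^sub>f"
      and bdd: "bdd_below (meal_energy f A b \<gamma> \<eta> (\<lambda>_. \<beta>) x z lam ` {1..})"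
    have "meal_alpha A \<gamma> \<eta> (\<lambda>_. \<beta>) k
        = (2 * \<beta> + \<gamma> * \<eta> * (1 - \<eta> / 2)) / (2 * meal_c \<gamma> A * \<beta>^2)" for k
      by (simp add: meal_alpha_def)
    from meal_run.stationarity_smallo[OF run[OF seq] L this _ _ bdd] small
    show "(\<lambda>k. meal_xi f A b \<gamma> (\<lambda>_. \<beta>) z lam k) \<in> o(\<lambda>k. 1 / sqrt (real k))" by simp
  next
    fix \<alpha>' Lhat\<^sub>f :: real and z\<^sub>0 :: "real^'n" and lam\<^sub>0 :: "real^'m" and E_low :: real
    assume pos: "0 < \<alpha>'"
      and small: "\<alpha>' \<le> min ((1 - \<rho> * \<gamma>) / (6 * \<gamma>)) (1 / (12 * \<gamma>) * (2 / \<eta> - 1))"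
      and L: "implicit_bounded_const \<gamma> f Lhat\<^sub>f"
    obtain y where y: "A *v y = b" using feasible by blast
    define D where "D = f y + 1 / (2 * \<gamma>) * (norm (y - z\<^sub>0))\<^sup>2
      + \<alpha>' * (2 * \<gamma> * (Lhat\<^sub>f + norm (transpose A *v lam\<^sub>0)) + 2 * norm (y - z\<^sub>0))\<^sup>2
      + 12 * \<gamma>\<^sup>2 * Lhat\<^sub>f\<^sup>2 * \<alpha>' - E_low"
    \<comment> \<open>\<open>\<bar>D\<bar> + 1\<close> instead of \<open>D\<close> makes \<open>c\<close> positive.\<close>
    define c where "c = sqrt ((\<bar>D\<bar> + 1) / (\<gamma> * \<eta> * (1 - \<eta> / 2) / 2))"
    show "\<exists>c>0. \<forall>K\<ge>1. \<forall>\<beta> x z lam.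
           meal_seq f A b \<gamma> \<eta> \<beta> x z lam \<longrightarrow>
           z 0 = z\<^sub>0 \<longrightarrow> lam 0 = lam\<^sub>0 \<longrightarrow>
           (\<forall>k. meal_alpha A \<gamma> \<eta> \<beta> k = \<alpha>' / real K) \<longrightarrow>
           (\<forall>k\<ge>1. E_low \<le> meal_energy_tilde f A b \<gamma> \<eta> \<beta> x z lam k) \<longrightarrow>
           meal_xi f A b \<gamma> \<beta> z lam K \<le> c / sqrt (real K)"
    proof (intro exI[of _ c] conjI allI impI)
      show "c > 0" using gam et by (simp add: c_def add_nonneg_pos)
      fix K :: nat and \<beta> :: "nat \<Rightarrow> real" and x z :: "nat \<Rightarrow> real^'n" and lam :: "nat \<Rightarrow> real^'m"
      assume K: "K \<ge> 1" and seq: "meal_seq f A b \<gamma> \<eta> \<beta> x z lam"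
        and init: "z 0 = z\<^sub>0" "lam 0 = lam\<^sub>0"
        and alpha: "\<forall>k. meal_alpha A \<gamma> \<eta> \<beta> k = \<alpha>' / real K"
        and low: "\<forall>k\<ge>1. E_low \<le> meal_energy_tilde f A b \<gamma> \<eta> \<beta> x z lam k"
      show "meal_xi f A b \<gamma> \<beta> z lam K \<le> c / sqrt (real K)"
        unfolding c_def
      proof (rule meal_run.stationarity_bound[OF run[OF seq] y L K _ pos])
        show "f y + 1 / (2 * \<gamma>) * (norm (y - z 0))\<^sup>2
          + \<alpha>' * (2 * \<gamma> * (Lhat\<^sub>f + norm (transpose A *v lam 0)) + 2 * norm (y - z 0))\<^sup>2
          + 12 * \<gamma>\<^sup>2 * Lhat\<^sub>f\<^sup>2 * \<alpha>' - E_low \<le> \<bar>D\<bar> + 1"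
          unfolding init D_def[symmetric] by linarith
      qed (use alpha low small in auto)
    qed
  }
qed

end
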